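(* Let $(Q,E)$ be a Finsler space with associated metric $g$ along $\tau\colon TQ\to Q$ and geodesic spray $\Gamma$. Let $K$ be a type $(1,1)$ tensor field along $\tau$ which is symmetric with respect to $g$, i.e. $g(KX,Y)=g(X,KY)$ for all $X,Y$, and which satisfies $$\nabla K=\tfrac12\left(\mathbf{T}\otimes\alpha-X_\alpha\otimes\theta_E\right)$$ for some 1-form $\alpha$ along $\tau$, where $X_\alpha$ is the vector field along $\tau$ determined by $g(X_\alpha,\cdot)=-\alpha$. Define functions $$k_0=E,\qquad k_j=\tfrac12\, g(\mathbf{T},K^j\mathbf{T}),\qquad a_j=\tfrac1j\,\mathrm{tr}\,K^j,\qquad j=1,2,\ldots,$$ $$\phi_1=0,\qquad \phi_k=\tfrac12\sum_{i=1}^{k-1}a_ia_{k-i}-\tfrac1k\sum_{i=2}^{k-1}(k-i)\,\phi_i\,a_{k-i}\quad (k\ge 2),\qquad b_k=\phi_k-a_k\quad(k\geq 1),$$ $$h_0=E,\qquad h_l=k_l+\sum_{i=1}^{l}b_i\,k_{l-i}\quad (l\ge 1).$$ Then for all $l$ the function $h_l$ is a first integral of $\Gamma$, i.e. $\Gamma(h_l)=0$ on $TQ\setminus\{0\}$.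
   Context: Setting. $Q$ is a smooth $n$-dimensional manifold, $\tau\colon TQ\to Q$ its tangent bundle, with natural coordinates $(q^i,u^i)$, and $TQ\setminus\{0\}$ is the tangent bundle with the zero section removed. $(Q,E)$ is a Finsler space: $E\colon TQ\to\mathbb{R}$ is the square of a Finsler function $F$ (a nonnegative function, smooth on $TQ\setminus\{0\}$ and positively homogeneous of degree one in the $u^i$); thus $E$ is homogeneous of degree two in the $u^i$, with $E=0$ on the zero section. It is assumed that the 2-form $\omega_E=d\theta_E$, with $\theta_E=\frac{\partial E}{\partial u^i}\,dq^i$, is non-degenerate on $TQ\setminus\{0\}$; equivalently, the matrix $g_{ij}(q,u)=\frac{\partial^2E}{\partial u^i\partial u^j}$ is everywhere non-singular there. Tensor fields along $\tau$ (restricted to $TQ\setminus\{0\}$) are tensor fields built with $\partial/\partial q^i$ and $dq^i$ whose coefficients are smooth functions of $(q,u)$ on $TQ\setminus\{0\}$ (sections of the pullback by $\tau$ of tensor bundles of $Q$). Examples: the Finsler metric $g=g_{ij}(q,u)\,dq^i\otimes dq^j$, the canonical vector field $\mathbf{T}=u^i\,\partial/\partial q^i$, and the 1-form $\theta_E=\frac{\partial E}{\partial u^i}dq^i=g(\mathbf{T},\cdot)$. For a vector field $X$ and 1-form $\beta$ along $\tau$, $X\otimes\beta$ denotes the type $(1,1)$ tensor $Y\mapsto\beta(Y)X$. The geodesic spray (canonical spray) of $E$ is the second-order vector field $\Gamma=u^i\frac{\partial}{\partial q^i}+F^i(q,u)\frac{\partial}{\partial u^i}$ on $TQ\setminus\{0\}$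 determined by the Euler–Lagrange equations $\Gamma\left(\frac{\partial E}{\partial u^i}\right)=\frac{\partial E}{\partial q^i}$. Put $\Gamma^j_i=-\frac12\frac{\partial F^j}{\partial u^i}$. The dynamical covariant derivative $\nabla$ is the degree-zero derivation of the algebra of tensor fields along $\tau$ (commuting with contractions) given by $\nabla f=\Gamma(f)$ on functions $f$ on $TQ\setminus\{0\}$, $\nabla(\partial/\partial q^i)=\Gamma^j_i\,\partial/\partial q^j$ and, by duality, $\nabla(dq^j)=-\Gamma^j_i\,dq^i$. On a type $(1,1)$ tensor, $(\nabla K)^i_j=\Gamma(K^i_j)+\Gamma^i_kK^k_j-\Gamma^k_jK^i_k$. *)

theory Defs
  imports "HOL-Analysis.Analysis"
begin

section \<open>Smooth maps, manifolds and tangent vectors\<close>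

primrec Ck_on ::
  "('a::real_normed_vector \<Rightarrow> 'b::real_normed_vector) \<Rightarrow> 'a set \<Rightarrow> nat \<Rightarrow> bool" where
  "Ck_on f S 0 \<longleftrightarrow> continuous_on S f"
| "Ck_on f S (Suc k) \<longleftrightarrow>
     (\<forall>x\<in>S. f differentiable (at x)) \<and> (\<forall>e. Ck_on (\<lambda>x. frechet_derivative f (at x) e) S k)"

text \<open>Only used for open sets \<open>S\<close>.\<close>

definition smooth_on ::
  "('a::real_normed_vector \<Rightarrow> 'b::real_normed_vector) \<Rightarrow> 'a set \<Rightarrow> bool" where
  "smooth_on f S \<longleftrightarrow> (\<forall>k. Ck_on f S k)"

text \<open>A chart is a pair of its domain and its coordinate map; the values of the map outside the
  domain are irrelevant. The model space \<open>'e\<close> is \<open>real^'n\<close> for \<open>Q\<close> and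
  \<open>real^'n \<times> real^'n\<close>, with coordinates \<open>(q, u)\<close>, for \<open>TQ\<close>.\<close>

type_synonym ('p, 'e) chart = "'p set \<times> ('p \<Rightarrow> 'e)"

definition chart_inv :: "('p, 'e) chart \<Rightarrow> 'e \<Rightarrow> 'p" where
  "chart_inv c = inv_into (fst c) (snd c)"

definition transition :: "('p, 'e) chart \<Rightarrow> ('p, 'e) chart \<Rightarrow> 'e \<Rightarrow> 'e" where
  "transition c c' = snd c' \<circ> chart_inv c"

definition smooth_manifold ::
  "'p topology \<Rightarrow> ('p, 'e::euclidean_space) chart set \<Rightarrow> bool" where
  "smooth_manifold M A \<longleftrightarrow>
     Hausdorff_space M \<and> second_countable M \<and>
     (\<Union>c\<in>A. fst c) = topspace M \<and>
     (\<forall>c\<in>A. openin M (fst c) \<and> open (snd c ` fst c) \<and>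
        homeomorphic_map (subtopology M (fst c)) (top_of_set (snd c ` fst c)) (snd c)) \<and>
     (\<forall>c\<in>A. \<forall>c'\<in>A. smooth_on (transition c c') (snd c ` (fst c \<inter> fst c')))"

text \<open>A tangent vector at \<open>p\<close> is the family of its component vectors in all charts around \<open>p\<close>,
  related by the Jacobians of the transition maps. The components in irrelevant charts are set
  to \<open>0\<close>, so that a tangent vector is determined by its components in one chart.\<close>

type_synonym ('p, 'e) tangent = "('p, 'e) chart \<Rightarrow> 'e"

definition tangent_space ::
  "('p, 'e::real_normed_vector) chart set \<Rightarrow> 'p \<Rightarrow> ('p, 'e) tangent set" where
  "tangent_space A p =
     {v. (\<forall>c\<in>A. \<forall>c'\<in>A. p \<in> fst c \<inter> fst c' \<longrightarrow>
            v c' = frechet_derivative (transition c c') (at (snd c p)) (v c)) \<and>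
         (\<forall>c. c \<notin> A \<or> p \<notin> fst c \<longrightarrow> v c = 0)}"

text \<open>The tangent vector at \<open>p\<close> whose components in the chart \<open>c\<close> are \<open>x\<close>.\<close>

definition tangent_of ::
  "('p, 'e::real_normed_vector) chart set \<Rightarrow> ('p, 'e) chart \<Rightarrow> 'p \<Rightarrow> 'e \<Rightarrow> ('p, 'e) tangent" where
  "tangent_of A c p x =
     (\<lambda>c'. if c' \<in> A \<and> p \<in> fst c' then frechet_derivative (transition c c') (at (snd c p)) x else 0)"

text \<open>The vector space operations of the fibres are componentwise: this is \<open>a X + b Y\<close>.\<close>

definition lincomb ::
  "real \<Rightarrow> ('p, 'e::real_normed_vector) tangent \<Rightarrow> real \<Rightarrow> ('p, 'e) tangent \<Rightarrow> ('p, 'e) tangent" where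
  "lincomb a X b Y = (\<lambda>c. a *\<^sub>R X c + b *\<^sub>R Y c)"

definition smooth_in ::
  "('p, 'e::real_normed_vector) chart \<Rightarrow> ('p \<Rightarrow> 'b::real_normed_vector) \<Rightarrow> bool" where
  "smooth_in c f \<longleftrightarrow> smooth_on (f \<circ> chart_inv c) (snd c ` fst c)"

text \<open>The derivative at \<open>p\<close> of \<open>f\<close>, expressed in the chart \<open>c\<close>, in the coordinate direction \<open>e\<close>.\<close>

definition chart_deriv ::
  "('p, 'e::real_normed_vector) chart \<Rightarrow> 'e \<Rightarrow> ('p \<Rightarrow> real) \<Rightarrow> 'p \<Rightarrow> real" where
  "chart_deriv c e f p = frechet_derivative (f \<circ> chart_inv c) (at (snd c p)) e"

definition vector_field ::
  "('p, 'e::real_normed_vector) chart set \<Rightarrow> ('p \<Rightarrow> ('p, 'e) tangent) \<Rightarrow> bool" where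
  "vector_field A X \<longleftrightarrow>
     (\<forall>p \<in> (\<Union>c\<in>A. fst c). X p \<in> tangent_space A p) \<and>
     (\<forall>c\<in>A. smooth_in c (\<lambda>p. X p c))"

text \<open>An arbitrary chart around \<open>p\<close>. It is only used in expressions that do not depend on the
  chart: the derivative of a function along a vector, the values of the Finsler metric \<open>g\<close> and
  of the 1-form \<open>\<theta>\<^sub>E\<close>, and the trace.\<close>

definition chart_at :: "('p, 'e) chart set \<Rightarrow> 'p \<Rightarrow> ('p, 'e) chart" where
  "chart_at A p = (SOME c. c \<in> A \<and> p \<in> fst c)"

definition lie_derivative ::
  "('p, 'e::real_normed_vector) chart set \<Rightarrow> ('p \<Rightarrow> ('p, 'e) tangent) \<Rightarrow> ('p \<Rightarrow> real) \<Rightarrow> 'p \<Rightarrow> real"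
  where
  "lie_derivative A X f p = (let c = chart_at A p in chart_deriv c (X p c) f p)"


section \<open>The tangent bundle and the slit tangent bundle\<close>

type_synonym ('p, 'n) tvec = "'p \<times> ('p, real^'n) tangent"

definition tangent_bundle :: "('p, real^'n) chart set \<Rightarrow> ('p, 'n) tvec set" where
  "tangent_bundle A = {(p, v). p \<in> (\<Union>c\<in>A. fst c) \<and> v \<in> tangent_space A p}"

definition slit_bundle :: "('p, real^'n) chart set \<Rightarrow> ('p, 'n) tvec set" where
  "slit_bundle A = {(p, v) \<in> tangent_bundle A. v \<noteq> (\<lambda>c. 0)}"

text \<open>The natural chart \<open>(q, u)\<close> induced by a chart \<open>c\<close> of \<open>Q\<close>, restricted to nonzero vectors.\<close>

definition lift_chart ::
  "('p, real^'n) chart set \<Rightarrow> ('p, real^'n) chart \<Rightarrow> (('p, 'n) tvec, (real^'n) \<times> (real^'n)) chart"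
  where
  "lift_chart A c = ({w \<in> slit_bundle A. fst w \<in> fst c}, \<lambda>(p, v). (snd c p, v c))"

definition slit_atlas ::
  "('p, real^'n) chart set \<Rightarrow> (('p, 'n) tvec, (real^'n) \<times> (real^'n)) chart set" where
  "slit_atlas A = lift_chart A ` A"

text \<open>The partial derivatives with respect to \<open>q\<^sup>i\<close> and \<open>u\<^sup>i\<close> in the natural chart induced by \<open>c\<close>.\<close>

definition d_q ::
  "('p, real^'n) chart set \<Rightarrow> ('p, real^'n) chart \<Rightarrow> 'n \<Rightarrow> (('p, 'n) tvec \<Rightarrow> real) \<Rightarrow> ('p, 'n) tvec \<Rightarrow> real"
  where
  "d_q A c i f = chart_deriv (lift_chart A c) (axis i 1, 0) f"

definition d_u ::
  "('p, real^'n) chart set \<Rightarrow> ('p, real^'n) chart \<Rightarrow> 'n \<Rightarrow> (('p, 'n) tvec \<Rightarrow> real) \<Rightarrow> ('p, 'n) tvec \<Rightarrow> real"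
  where
  "d_u A c i f = chart_deriv (lift_chart A c) (0, axis i 1) f"


section \<open>Tensor fields along the bundle projection\<close>

text \<open>The value of such a field at \<open>w = (p, v)\<close> is a tensor on the tangent space of \<open>Q\<close> at
  \<open>p = fst w\<close>. The canonical vector field \<open>\<^bold>T\<close> is \<open>snd\<close>.\<close>

definition vector_field_along ::
  "('p, real^'n) chart set \<Rightarrow> (('p, 'n) tvec \<Rightarrow> ('p, real^'n) tangent) \<Rightarrow> bool" where
  "vector_field_along A X \<longleftrightarrow>
     (\<forall>w\<in>slit_bundle A. X w \<in> tangent_space A (fst w)) \<and>
     (\<forall>c\<in>A. \<forall>i. smooth_in (lift_chart A c) (\<lambda>w. X w c $ i))"

definition covector_component ::
  "('p, real^'n) chart set \<Rightarrow> ('p, real^'n) chart \<Rightarrow> (('p, 'n) tvec \<Rightarrow> ('p, real^'n) tangent \<Rightarrow> real)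
    \<Rightarrow> 'n \<Rightarrow> ('p, 'n) tvec \<Rightarrow> real" where
  "covector_component A c \<alpha> j w = \<alpha> w (tangent_of A c (fst w) (axis j 1))"

definition one_form_along ::
  "('p, real^'n) chart set \<Rightarrow> (('p, 'n) tvec \<Rightarrow> ('p, real^'n) tangent \<Rightarrow> real) \<Rightarrow> bool" where
  "one_form_along A \<alpha> \<longleftrightarrow>
     (\<forall>w\<in>slit_bundle A. \<forall>X\<in>tangent_space A (fst w). \<forall>Y\<in>tangent_space A (fst w). \<forall>a b.
        \<alpha> w (lincomb a X b Y) = a * \<alpha> w X + b * \<alpha> w Y) \<and>
     (\<forall>c\<in>A. \<forall>j. smooth_in (lift_chart A c) (covector_component A c \<alpha> j))"

text \<open>The matrix in the chart \<open>c\<close> of an endomorphism \<open>L\<close> of the tangent space at \<open>p\<close>.\<close>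

definition endo_matrix ::
  "('p, real^'n) chart set \<Rightarrow> ('p, real^'n) chart \<Rightarrow> 'p
    \<Rightarrow> (('p, real^'n) tangent \<Rightarrow> ('p, real^'n) tangent) \<Rightarrow> real^'n^'n" where
  "endo_matrix A c p L = (\<chi> i j. L (tangent_of A c p (axis j 1)) c $ i)"

definition tensor11_component ::
  "('p, real^'n) chart set \<Rightarrow> ('p, real^'n) chart
    \<Rightarrow> (('p, 'n) tvec \<Rightarrow> ('p, real^'n) tangent \<Rightarrow> ('p, real^'n) tangent)
    \<Rightarrow> 'n \<Rightarrow> 'n \<Rightarrow> ('p, 'n) tvec \<Rightarrow> real" where
  "tensor11_component A c K i j w = endo_matrix A c (fst w) (K w) $ i $ j"

definition tensor11_along ::
  "('p, real^'n) chart set \<Rightarrow> (('p, 'n) tvec \<Rightarrow> ('p, real^'n) tangent \<Rightarrow> ('p, real^'n) tangent) \<Rightarrow> bool"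
  where
  "tensor11_along A K \<longleftrightarrow>
     (\<forall>w\<in>slit_bundle A. \<forall>X\<in>tangent_space A (fst w). K w X \<in> tangent_space A (fst w)) \<and>
     (\<forall>w\<in>slit_bundle A. \<forall>X\<in>tangent_space A (fst w). \<forall>Y\<in>tangent_space A (fst w). \<forall>a b.
        K w (lincomb a X b Y) = lincomb a (K w X) b (K w Y)) \<and>
     (\<forall>c\<in>A. \<forall>i j. smooth_in (lift_chart A c) (tensor11_component A c K i j))"

definition fibre_trace ::
  "('p, real^'n) chart set \<Rightarrow> 'p \<Rightarrow> (('p, real^'n) tangent \<Rightarrow> ('p, real^'n) tangent) \<Rightarrow> real" where
  "fibre_trace A p L = trace (endo_matrix A (chart_at A p) p L)"

text \<open>The type \<open>(1,1)\<close> tensor field \<open>X \<otimes> \<beta>\<close>.\<close>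

definition tensor_prod ::
  "(('p, 'n) tvec \<Rightarrow> ('p, real^'n) tangent) \<Rightarrow> (('p, 'n) tvec \<Rightarrow> ('p, real^'n) tangent \<Rightarrow> real)
    \<Rightarrow> ('p, 'n) tvec \<Rightarrow> ('p, real^'n) tangent \<Rightarrow> ('p, real^'n) tangent" where
  "tensor_prod X \<beta> w Y = (\<lambda>c. \<beta> w Y *\<^sub>R X w c)"


section \<open>Finsler spaces\<close>

definition finsler_metric ::
  "('p, real^'n) chart set \<Rightarrow> (('p, 'n) tvec \<Rightarrow> real)
    \<Rightarrow> ('p, 'n) tvec \<Rightarrow> ('p, real^'n) tangent \<Rightarrow> ('p, real^'n) tangent \<Rightarrow> real" where
  "finsler_metric A E w X Y =
     (let c = chart_at A (fst w) in
       \<Sum>i\<in>UNIV. \<Sum>j\<in>UNIV. d_u A c i (d_u A c j E) w * X c $ i * Y c $ j)"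

definition theta ::
  "('p, real^'n) chart set \<Rightarrow> (('p, 'n) tvec \<Rightarrow> real)
    \<Rightarrow> ('p, 'n) tvec \<Rightarrow> ('p, real^'n) tangent \<Rightarrow> real" where
  "theta A E w Y = (let c = chart_at A (fst w) in \<Sum>i\<in>UNIV. d_u A c i E w * Y c $ i)"

text \<open>In the natural chart induced by \<open>c\<close>: the 1-form \<open>(\<partial>E/\<partial>u\<^sup>i) dq\<^sup>i\<close> on the slit tangent bundle,
  and its exterior derivative, evaluated on vectors with constant components
  \<open>\<xi> = (\<delta>q, \<delta>u)\<close> and \<open>\<eta>\<close>.\<close>

definition cartan_form1 ::
  "('p, real^'n) chart set \<Rightarrow> ('p, real^'n) chart \<Rightarrow> (('p, 'n) tvec \<Rightarrow> real)
    \<Rightarrow> (real^'n) \<times> (real^'n) \<Rightarrow> ('p, 'n) tvec \<Rightarrow> real" where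
  "cartan_form1 A c E \<xi> w = (\<Sum>i\<in>UNIV. d_u A c i E w * fst \<xi> $ i)"

definition cartan_form2 ::
  "('p, real^'n) chart set \<Rightarrow> ('p, real^'n) chart \<Rightarrow> (('p, 'n) tvec \<Rightarrow> real)
    \<Rightarrow> (real^'n) \<times> (real^'n) \<Rightarrow> (real^'n) \<times> (real^'n) \<Rightarrow> ('p, 'n) tvec \<Rightarrow> real" where
  "cartan_form2 A c E \<xi> \<eta> w =
     chart_deriv (lift_chart A c) \<xi> (cartan_form1 A c E \<eta>) w -
     chart_deriv (lift_chart A c) \<eta> (cartan_form1 A c E \<xi>) w"

definition finsler_function ::
  "('p, real^'n) chart set \<Rightarrow> (('p, 'n) tvec \<Rightarrow> real) \<Rightarrow> bool" where
  "finsler_function A F \<longleftrightarrow>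
     (\<forall>w\<in>tangent_bundle A. F w \<ge> 0) \<and>
     (\<forall>C\<in>slit_atlas A. smooth_in C F) \<and>
     (\<forall>(p, v)\<in>tangent_bundle A. \<forall>r>0. F (p, \<lambda>c. r *\<^sub>R v c) = r * F (p, v))"

definition finsler_space ::
  "('p, real^'n) chart set \<Rightarrow> (('p, 'n) tvec \<Rightarrow> real) \<Rightarrow> bool" where
  "finsler_space A E \<longleftrightarrow>
     (\<exists>F. finsler_function A F \<and> (\<forall>w\<in>tangent_bundle A. E w = (F w)\<^sup>2)) \<and>
     (\<forall>c\<in>A. \<forall>w\<in>fst (lift_chart A c). \<forall>\<xi>.
        (\<forall>\<eta>. cartan_form2 A c E \<xi> \<eta> w = 0) \<longrightarrow> \<xi> = 0)"

definition geodesic_spray ::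
  "('p, real^'n) chart set \<Rightarrow> (('p, 'n) tvec \<Rightarrow> real)
    \<Rightarrow> (('p, 'n) tvec \<Rightarrow> (('p, 'n) tvec, (real^'n) \<times> (real^'n)) tangent) \<Rightarrow> bool" where
  "geodesic_spray A E \<Gamma> \<longleftrightarrow>
     vector_field (slit_atlas A) \<Gamma> \<and>
     (\<forall>c\<in>A. \<forall>w\<in>fst (lift_chart A c).
        fst (\<Gamma> w (lift_chart A c)) = snd w c \<and>
        (\<forall>i. chart_deriv (lift_chart A c) (\<Gamma> w (lift_chart A c)) (d_u A c i E) w = d_q A c i E w))"

text \<open>The connection coefficient \<open>\<Gamma>\<^sup>j\<^sub>i\<close>, with upper index \<open>j\<close>, and the components of the
  dynamical covariant derivative of a type \<open>(1,1)\<close> tensor field, in the chart \<open>c\<close>.\<close>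

definition conn_coeff ::
  "('p, real^'n) chart set \<Rightarrow> ('p, real^'n) chart
    \<Rightarrow> (('p, 'n) tvec \<Rightarrow> (('p, 'n) tvec, (real^'n) \<times> (real^'n)) tangent)
    \<Rightarrow> 'n \<Rightarrow> 'n \<Rightarrow> ('p, 'n) tvec \<Rightarrow> real" where
  "conn_coeff A c \<Gamma> j i w = - (1/2) * d_u A c i (\<lambda>w'. snd (\<Gamma> w' (lift_chart A c)) $ j) w"

definition nabla11 ::
  "('p, real^'n) chart set \<Rightarrow> ('p, real^'n) chart
    \<Rightarrow> (('p, 'n) tvec \<Rightarrow> (('p, 'n) tvec, (real^'n) \<times> (real^'n)) tangent)
    \<Rightarrow> (('p, 'n) tvec \<Rightarrow> ('p, real^'n) tangent \<Rightarrow> ('p, real^'n) tangent)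
    \<Rightarrow> 'n \<Rightarrow> 'n \<Rightarrow> ('p, 'n) tvec \<Rightarrow> real" where
  "nabla11 A c \<Gamma> K i j w =
     chart_deriv (lift_chart A c) (\<Gamma> w (lift_chart A c)) (tensor11_component A c K i j) w +
     (\<Sum>k\<in>UNIV. conn_coeff A c \<Gamma> i k w * tensor11_component A c K k j w) -
     (\<Sum>k\<in>UNIV. conn_coeff A c \<Gamma> k j w * tensor11_component A c K i k w)"


section \<open>The functions \<open>h\<^sub>l\<close>\<close>

definition k_fun ::
  "('p, real^'n) chart set \<Rightarrow> (('p, 'n) tvec \<Rightarrow> real)
    \<Rightarrow> (('p, 'n) tvec \<Rightarrow> ('p, real^'n) tangent \<Rightarrow> ('p, real^'n) tangent)
    \<Rightarrow> nat \<Rightarrow> ('p, 'n) tvec \<Rightarrow> real" where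
  "k_fun A E K j w =
     (if j = 0 then E w else 1/2 * finsler_metric A E w (snd w) ((K w ^^ j) (snd w)))"

definition a_fun ::
  "('p, real^'n) chart set
    \<Rightarrow> (('p, 'n) tvec \<Rightarrow> ('p, real^'n) tangent \<Rightarrow> ('p, real^'n) tangent)
    \<Rightarrow> nat \<Rightarrow> ('p, 'n) tvec \<Rightarrow> real" where
  "a_fun A K j w = 1 / real j * fibre_trace A (fst w) (K w ^^ j)"

text \<open>The index \<open>0\<close>, for which \<open>\<phi>\<close> is not defined, is never used.\<close>

fun phi_seq :: "(nat \<Rightarrow> real) \<Rightarrow> nat \<Rightarrow> real" where
  "phi_seq a k =
     (if k \<le> 1 then 0
      else 1/2 * (\<Sum>i = 1..k - 1. a i * a (k - i)) -
           1 / real k * (\<Sum>i = 2..k - 1. real (k - i) * phi_seq a i * a (k - i)))"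

declare phi_seq.simps [simp del]

definition b_fun ::
  "('p, real^'n) chart set
    \<Rightarrow> (('p, 'n) tvec \<Rightarrow> ('p, real^'n) tangent \<Rightarrow> ('p, real^'n) tangent)
    \<Rightarrow> nat \<Rightarrow> ('p, 'n) tvec \<Rightarrow> real" where
  "b_fun A K k w = phi_seq (\<lambda>j. a_fun A K j w) k - a_fun A K k w"

definition h_fun ::
  "('p, real^'n) chart set \<Rightarrow> (('p, 'n) tvec \<Rightarrow> real)
    \<Rightarrow> (('p, 'n) tvec \<Rightarrow> ('p, real^'n) tangent \<Rightarrow> ('p, real^'n) tangent)
    \<Rightarrow> nat \<Rightarrow> ('p, 'n) tvec \<Rightarrow> real" where
  "h_fun A E K l w =
     (if l = 0 then E w
      else k_fun A E K l w + (\<Sum>i = 1..l. b_fun A K i w * k_fun A E K (l - i) w))"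

end

theory Submission
  imports Defs "HOL-Computational_Algebra.Formal_Power_Series"
begin

text \<open>The spray satisfies \<open>\<nabla>g = 0\<close> and \<open>\<nabla>\<^bold>T = 0\<close>: both follow from the Euler-Lagrange equations,
  differentiated in the vertical directions, and the homogeneity of \<open>E\<close>. With
  \<open>c\<^sub>j = g (X\<^sub>\<alpha>, K^j \<^bold>T)\<close> the hypothesis on \<open>\<nabla>K\<close> then yields \<open>\<Gamma> a\<^sub>j = - c\<^sub>j\<^sub>-\<^sub>1\<close> and
  \<open>\<Gamma> k\<^sub>j = - \<Sum>i<j. k\<^sub>i c\<^sub>j\<^sub>-\<^sub>1\<^sub>-\<^sub>i\<close>. For the generating series \<open>A\<close>, \<open>B\<close>, \<open>H\<close>, \<open>k\<close> of \<open>a\<close>, \<open>b\<close>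
  (with \<open>b\<^sub>0 = 1\<close>), \<open>h\<close> and \<open>k\<close> this says \<open>\<Gamma> k = k \<cdot> \<Gamma> A\<close>; the recursion for \<open>\<phi>\<close> is
  the logarithmic derivative of \<open>B = exp (- A)\<close>, so \<open>\<Gamma> B = - B \<cdot> \<Gamma> A\<close> and \<open>H = B \<cdot> k\<close> is conserved.\<close>

section \<open>Directional derivatives\<close>

text \<open>The series have closed forms. As a_j = tr K^j / j, A = - log det (1 - t K), so B = det
  (1 - t K) and H = 1/2 det (1 - t K) g(T, (1 - t K)^{-1} T): the h_l are the coefficients of 1/2
  g(T, adj (1 - t K) T). The proof works with the differential equations in t only, so no
  determinant appears. The two facts about the spray differ in depth. Symmetrising the
  differentiated Euler-Lagrange equations is enough for the parallel metric, whereas the parallel T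
  says that the force is homogeneous of degree two, and there nondegeneracy enters. The trace, the
  metric and the form \<open>theta\<close> are evaluated in a chart chosen separately at each point,
  and this choice may jump between neighbouring points. Chart independence must therefore come
  before any differentiation. It holds for the trace because the matrices in two charts are
  conjugate, and for the other two because natural charts are linear along fibres.\<close>

definition dd :: "('a::real_normed_vector \<Rightarrow> 'b::real_normed_vector) \<Rightarrow> 'a \<Rightarrow> 'a \<Rightarrow> 'b" where
  "dd f v x = frechet_derivative f (at x) v"

lemma dd_eqI: "(f has_derivative f') (at x) \<Longrightarrow> dd f v x = f' v"
  by (metis dd_def frechet_derivative_at)

lemma has_derivative_dd: "f differentiable (at x) \<Longrightarrow> (f has_derivative (\<lambda>v. dd f v x)) (at x)"
  unfolding dd_def by (simp add: frechet_derivative_works)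

lemma linear_dd: "f differentiable (at x) \<Longrightarrow> linear (\<lambda>v. dd f v x)"
  using has_derivative_dd has_derivative_linear by blast

lemma dd_add: "f differentiable (at x) \<Longrightarrow> dd f (v + w) x = dd f v x + dd f w x"
  by (rule linear_add[OF linear_dd])

lemma dd_scaleR: "f differentiable (at x) \<Longrightarrow> dd f (r *\<^sub>R v) x = r *\<^sub>R dd f v x"
  by (rule linear_cmul[OF linear_dd])

text \<open>\<open>frechet_derivative\<close> chooses among all derivatives of a function; functions
  with the same derivatives get the same choice, even at points where there is none.\<close>

lemma frechet_derivative_cong_open:
  assumes "open U" "x \<in> U" "\<And>y. y \<in> U \<Longrightarrow> f y = g y"
  shows "frechet_derivative f (at x) = frechet_derivative g (at x)"
proof -
  have "(f has_derivative D) (at x) = (g has_derivative D) (at x)" for D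
    using assms has_derivative_transform_within_open[of f D x UNIV U g]
      has_derivative_transform_within_open[of g D x UNIV U f] by auto
  then show ?thesis
    unfolding frechet_derivative_def by simp
qed

lemma dd_cong:
  assumes "open U" "x \<in> U" "\<And>y. y \<in> U \<Longrightarrow> f y = g y"
  shows "dd f v x = dd g v x"
  unfolding dd_def using frechet_derivative_cong_open[OF assms] by simp

lemma smooth_on_differentiable: "smooth_on f U \<Longrightarrow> x \<in> U \<Longrightarrow> f differentiable (at x)"
  unfolding smooth_on_def by (metis Ck_on.simps(2))

lemma smooth_on_continuous: "smooth_on f U \<Longrightarrow> continuous_on U f"
  unfolding smooth_on_def by (metis Ck_on.simps(1))

text \<open>The reason why \<open>dd\<close> takes the direction before the point:
  \<open>dd f v\<close> is again a function on the same space, so higher derivatives are iterated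
  \<open>dd\<close>.\<close>

lemma smooth_on_dd: "smooth_on f U \<Longrightarrow> smooth_on (dd f v) U"
  unfolding smooth_on_def dd_def by (metis Ck_on.simps(2))

section \<open>Symmetry of second derivatives\<close>

lemma dd_along_line:
  fixes f :: "'a::real_normed_vector \<Rightarrow> real"
  assumes "f differentiable (at (x + t *\<^sub>R v))"
  shows "((\<lambda>t. f (x + t *\<^sub>R v)) has_real_derivative dd f v (x + t *\<^sub>R v)) (at t)"
proof -
  have "((\<lambda>t. x + t *\<^sub>R v) has_derivative (\<lambda>h. h *\<^sub>R v)) (at t)"
    by (auto intro!: derivative_eq_intros)
  from has_derivative_compose[OF this has_derivative_dd[OF assms]]
  have "((\<lambda>t. f (x + t *\<^sub>R v)) has_derivative (\<lambda>h. dd f v (x + t *\<^sub>R v) * h)) (at t)"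
    by (rule has_derivative_eq_rhs) (simp add: dd_scaleR[OF assms] fun_eq_iff)
  then show ?thesis
    by (simp add: has_field_derivative_def)
qed

text \<open>The mean value theorem, first along \<open>a\<close> and then along \<open>b\<close>.
  The second difference on the left is symmetric in \<open>a\<close> and \<open>b\<close>, the
  derivative on the right is not visibly so; comparing both orders yields
  \<open>dd_commute\<close>.\<close>

lemma second_difference_mean_value:
  fixes f :: "'a::real_normed_vector \<Rightarrow> real"
  assumes smooth: "smooth_on f U" and "h > 0"
    and box: "\<And>s t. 0 \<le> s \<Longrightarrow> s \<le> h \<Longrightarrow> 0 \<le> t \<Longrightarrow> t \<le> h \<Longrightarrow> x + s *\<^sub>R a + t *\<^sub>R b \<in> U"
  shows "\<exists>s t. 0 < s \<and> s < h \<and> 0 < t \<and> t < h \<and>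
     f (x + h *\<^sub>R a + h *\<^sub>R b) - f (x + h *\<^sub>R a) - f (x + h *\<^sub>R b) + f x =
       h * h * dd (dd f a) b (x + s *\<^sub>R a + t *\<^sub>R b)"
proof -
  note diff = smooth_on_differentiable[OF smooth]
  \<comment> \<open>The difference of \<open>f\<close> across the side \<open>h *\<^sub>R b\<close>,
    as a function of the position along \<open>a\<close>.\<close>
  define p where "p s = f ((x + h *\<^sub>R b) + s *\<^sub>R a) - f (x + s *\<^sub>R a)" for s
  define p' where "p' s = dd f a ((x + h *\<^sub>R b) + s *\<^sub>R a) - dd f a (x + s *\<^sub>R a)" for s
  have "(p has_real_derivative p' s) (at s)" if "0 \<le> s" "s \<le> h" for s
    unfolding p_def p'_def
    using box[OF that, of h] box[OF that, of 0] \<open>h > 0\<close>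
    by (intro DERIV_diff dd_along_line diff) (auto simp: algebra_simps)
  then obtain s where s: "0 < s" "s < h" "p h - p 0 = (h - 0) * p' s"
    using MVT2[of 0 h p p'] \<open>h > 0\<close> by auto
  have "((\<lambda>t. dd f a ((x + s *\<^sub>R a) + t *\<^sub>R b)) has_real_derivative
      dd (dd f a) b ((x + s *\<^sub>R a) + t *\<^sub>R b)) (at t)" if "0 \<le> t" "t \<le> h" for t
    using box[of s t] s that
    by (intro dd_along_line smooth_on_differentiable[OF smooth_on_dd[OF smooth]]) auto
  then obtain t where t: "0 < t" "t < h"
    "dd f a ((x + s *\<^sub>R a) + h *\<^sub>R b) - dd f a ((x + s *\<^sub>R a) + 0 *\<^sub>R b) =
      (h - 0) * dd (dd f a) b ((x + s *\<^sub>R a) + t *\<^sub>R b)"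
    using MVT2[of 0 h "\<lambda>t. dd f a ((x + s *\<^sub>R a) + t *\<^sub>R b)"
        "\<lambda>t. dd (dd f a) b ((x + s *\<^sub>R a) + t *\<^sub>R b)"] \<open>h > 0\<close> by blast
  have "p' s = h * dd (dd f a) b ((x + s *\<^sub>R a) + t *\<^sub>R b)"
    using t(3) by (simp add: p'_def add_ac)
  then have "p h - p 0 = h * h * dd (dd f a) b (x + s *\<^sub>R a + t *\<^sub>R b)"
    using s(3) by simp
  moreover have "p h - p 0 = f (x + h *\<^sub>R a + h *\<^sub>R b) - f (x + h *\<^sub>R a) - f (x + h *\<^sub>R b) + f x"
    by (simp add: p_def add_ac)
  ultimately show ?thesis
    using s t by metis
qed

text \<open>If the two mixed derivatives differed at \<open>x\<close>, continuity would keep each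
  within half of the gap near \<open>x\<close>. The symmetric second difference of a small
  parallelogram, however, equals h^2 times a value of either one.\<close>

lemma dd_commute:
  fixes f :: "'a::real_normed_vector \<Rightarrow> real"
  assumes smooth: "smooth_on f U" and "open U" "x \<in> U"
  shows "dd (dd f a) b x = dd (dd f b) a x"
proof (rule ccontr)
  define P where "P = dd (dd f a) b"
  define Q where "Q = dd (dd f b) a"
  assume "\<not> ?thesis"
  then have pos: "\<bar>P x - Q x\<bar> / 2 > 0" (is "?e > 0")
    by (simp add: P_def Q_def)
  have "isCont P x" "isCont Q x"
    unfolding P_def Q_def using smooth_on_continuous[OF smooth_on_dd[OF smooth_on_dd[OF smooth]]]
      continuous_on_eq_continuous_at[OF \<open>open U\<close>] \<open>x \<in> U\<close> by blast+
  then have "\<exists>d1>0. \<forall>y. dist y x < d1 \<longrightarrow> dist (P y) (P x) < ?e"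
    "\<exists>d2>0. \<forall>y. dist y x < d2 \<longrightarrow> dist (Q y) (Q x) < ?e"
    using pos unfolding continuous_at_eps_delta by presburger+
  then obtain d1 d2 where d1: "d1 > 0" "\<And>y. dist y x < d1 \<Longrightarrow> dist (P y) (P x) < ?e"
    and d2: "d2 > 0" "\<And>y. dist y x < d2 \<Longrightarrow> dist (Q y) (Q x) < ?e"
    by auto
  obtain d3 where d3: "d3 > 0" "\<And>y. dist y x < d3 \<Longrightarrow> y \<in> U"
    using \<open>open U\<close> \<open>x \<in> U\<close> unfolding open_dist by metis
  define d where "d = min d1 (min d2 d3)"
  have d: "d > 0" using d1 d2 d3 by (simp add: d_def)
  \<comment> \<open>This side length keeps the parallelogram inside the ball of radius
    \<open>d\<close>; the summand 1 covers the case that \<open>a\<close> and \<open>b\<close> both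
    vanish.\<close>
  define h where "h = d / (2 * (norm a + norm b + 1))"
  have h: "h > 0" using d by (simp add: h_def add_nonneg_pos)
  have near: "dist (x + s *\<^sub>R a + t *\<^sub>R b) x < d" if "0 \<le> s" "s \<le> h" "0 \<le> t" "t \<le> h" for s t
  proof -
    have "norm (s *\<^sub>R a + t *\<^sub>R b) \<le> s * norm a + t * norm b"
      using norm_triangle_ineq[of "s *\<^sub>R a" "t *\<^sub>R b"] that by simp
    also have "\<dots> \<le> h * norm a + h * norm b"
      using that by (intro add_mono mult_right_mono) auto
    also have "\<dots> < h * (2 * (norm a + norm b + 1))"
      using h by (simp add: algebra_simps add_nonneg_pos add_pos_nonneg)
    also have "\<dots> = d"
    proof -
      have "norm a + norm b + 1 \<noteq> 0"
        by (smt (verit) norm_ge_zero)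
      then show ?thesis unfolding h_def by simp
    qed
    finally show ?thesis by (simp add: dist_norm add.assoc)
  qed
  have inU: "x + s *\<^sub>R a + t *\<^sub>R b \<in> U" if "0 \<le> s" "s \<le> h" "0 \<le> t" "t \<le> h" for s t
    using near[OF that] d3(2) by (simp add: d_def)
  have inU': "x + s *\<^sub>R b + t *\<^sub>R a \<in> U" if "0 \<le> s" "s \<le> h" "0 \<le> t" "t \<le> h" for s t
    using inU[OF that(3,4,1,2)] by (simp add: add_ac)
  obtain s t where st: "0 < s" "s < h" "0 < t" "t < h"
    "f (x + h *\<^sub>R a + h *\<^sub>R b) - f (x + h *\<^sub>R a) - f (x + h *\<^sub>R b) + f x =
       h * h * P (x + s *\<^sub>R a + t *\<^sub>R b)"
    unfolding P_def using second_difference_mean_value[OF smooth h inU] by blast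
  obtain s' t' where st': "0 < s'" "s' < h" "0 < t'" "t' < h"
    "f (x + h *\<^sub>R b + h *\<^sub>R a) - f (x + h *\<^sub>R b) - f (x + h *\<^sub>R a) + f x =
       h * h * Q (x + s' *\<^sub>R b + t' *\<^sub>R a)"
    unfolding Q_def using second_difference_mean_value[OF smooth h inU'] by blast
  have "h * h * P (x + s *\<^sub>R a + t *\<^sub>R b) = h * h * Q (x + t' *\<^sub>R a + s' *\<^sub>R b)"
  proof -
    have "x + h *\<^sub>R b + h *\<^sub>R a = x + h *\<^sub>R a + h *\<^sub>R b"
      "x + s' *\<^sub>R b + t' *\<^sub>R a = x + t' *\<^sub>R a + s' *\<^sub>R b"
      by (simp_all add: add_ac)
    with st(5) st'(5) show ?thesis by (simp only:)
  qed
  then have "P (x + s *\<^sub>R a + t *\<^sub>R b) = Q (x + t' *\<^sub>R a + s' *\<^sub>R b)"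
    using h by (metis less_irrefl mult_eq_0_iff mult_left_cancel)
  moreover have "dist (P (x + s *\<^sub>R a + t *\<^sub>R b)) (P x) < ?e"
    using near[of s t] st(1-4) by (intro d1(2)) (simp add: d_def)
  moreover have "dist (Q (x + t' *\<^sub>R a + s' *\<^sub>R b)) (Q x) < ?e"
    using near[of t' s'] st'(1-4) by (intro d2(2)) (simp add: d_def)
  ultimately have "dist (P x) (Q x) < ?e + ?e"
    using dist_triangle3[of "P x" "Q x" "P (x + s *\<^sub>R a + t *\<^sub>R b)"] by (simp only:)
  then show False
    by (simp add: dist_real_def)
qed

text \<open>A product rule for a derivative whose direction moves with the point. It is applied to
  the fields (0, u), for Euler identities, and (u, F), for the Euler-Lagrange equations.\<close>

lemma has_derivative_dd_along_field:
  fixes f :: "'a::euclidean_space \<Rightarrow> real"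
  assumes smooth: "smooth_on f U" and "open U" "x \<in> U"
    and W: "(W has_derivative W') (at x)"
  shows "((\<lambda>y. dd f (W y) y) has_derivative (\<lambda>b. dd (dd f (W x)) b x + dd f (W' b) x)) (at x)"
proof -
  note diff = smooth_on_differentiable[OF smooth]
  note diff2 = smooth_on_differentiable[OF smooth_on_dd[OF smooth] \<open>x \<in> U\<close>]
  \<comment> \<open>Expansion in an orthonormal basis leaves finitely many derivatives in fixed
    directions, with the coordinates of the moving direction as coefficients.\<close>
  have expand: "dd f v y = (\<Sum>i\<in>Basis. (v \<bullet> i) * dd f i y)" if "y \<in> U" for v y
  proof -
    have "dd f v y = dd f (\<Sum>i\<in>Basis. (v \<bullet> i) *\<^sub>R i) y"
      by (simp add: euclidean_representation)
    also have "\<dots> = (\<Sum>i\<in>Basis. dd f ((v \<bullet> i) *\<^sub>R i) y)"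
      by (rule linear_sum[OF linear_dd[OF diff[OF that]]])
    finally show ?thesis by (simp add: dd_scaleR[OF diff[OF that]])
  qed
  have expand2: "dd (dd f v) b x = (\<Sum>i\<in>Basis. (v \<bullet> i) * dd (dd f i) b x)" for v b
  proof -
    have "((\<lambda>y. \<Sum>i\<in>Basis. (v \<bullet> i) * dd f i y) has_derivative
        (\<lambda>b. \<Sum>i\<in>Basis. (v \<bullet> i) * dd (dd f i) b x)) (at x)"
      by (intro has_derivative_sum has_derivative_mult_right has_derivative_dd diff2)
    then have "(dd f v has_derivative (\<lambda>b. \<Sum>i\<in>Basis. (v \<bullet> i) * dd (dd f i) b x)) (at x)"
      by (rule has_derivative_transform_within_open[OF _ \<open>open U\<close> \<open>x \<in> U\<close>]) (rule expand[symmetric])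
    then show ?thesis by (rule dd_eqI)
  qed
  have "((\<lambda>y. \<Sum>i\<in>Basis. (W y \<bullet> i) * dd f i y) has_derivative
      (\<lambda>b. \<Sum>i\<in>Basis. (W x \<bullet> i) * dd (dd f i) b x + (W' b \<bullet> i) * dd f i x)) (at x)"
    by (intro has_derivative_sum has_derivative_mult has_derivative_inner_left has_derivative_dd diff2 W)
  then have "((\<lambda>y. dd f (W y) y) has_derivative
      (\<lambda>b. \<Sum>i\<in>Basis. (W x \<bullet> i) * dd (dd f i) b x + (W' b \<bullet> i) * dd f i x)) (at x)"
    by (rule has_derivative_transform_within_open[OF _ \<open>open U\<close> \<open>x \<in> U\<close>]) (rule expand[symmetric])
  then show ?thesis
    by (simp add: sum.distrib expand2[of "W x"] expand[OF \<open>x \<in> U\<close>, of "W' _"])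
qed

text \<open>Symmetry moves \<open>v\<close> to the outer derivative, where linearity is
  immediate.\<close>

lemma linear_dd_field_direction:
  fixes f :: "'a::euclidean_space \<Rightarrow> real"
  assumes smooth: "smooth_on f U" and "open U" "x \<in> U"
  shows "linear (\<lambda>v. dd (dd f v) b x)"
proof -
  have "linear (\<lambda>v. dd (dd f b) v x)"
    using linear_dd smooth_on_differentiable smooth_on_dd smooth \<open>x \<in> U\<close> by blast
  then show ?thesis
    by (simp add: dd_commute[OF assms, of _ b])
qed


section \<open>Geodesic sprays in coordinates\<close>

text \<open>The situation in one natural chart, free of bases: the Euler-Lagrange equations are
  contracted with an arbitrary constant \<eta>, and nondegeneracy is that of the vertical
  Hessian.\<close>

locale local_spray =
  fixes U :: "('a::euclidean_space \<times> 'a) set" and e :: "'a \<times> 'a \<Rightarrow> real"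
    and F :: "'a \<times> 'a \<Rightarrow> 'a"
  assumes open_dom: "open U"
    and smooth: "smooth_on e U"
    and force_differentiable: "\<And>x. x \<in> U \<Longrightarrow> F differentiable (at x)"
    and cone: "\<And>q u r. (q, u) \<in> U \<Longrightarrow> r > 0 \<Longrightarrow> (q, r *\<^sub>R u) \<in> U"
    and homogeneous: "\<And>q u r. (q, u) \<in> U \<Longrightarrow> r > 0 \<Longrightarrow> e (q, r *\<^sub>R u) = r\<^sup>2 * e (q, u)"
    and euler_lagrange: "\<And>x \<eta>. x \<in> U \<Longrightarrow> dd (dd e (0, \<eta>)) (snd x, F x) x = dd e (\<eta>, 0) x"
    and nondegenerate: "\<And>x \<xi>. x \<in> U \<Longrightarrow> (\<And>\<eta>. dd (dd e (0, \<xi>)) (0, \<eta>) x = 0) \<Longrightarrow> \<xi> = 0"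
begin

definition metric :: "'a \<times> 'a \<Rightarrow> 'a \<Rightarrow> 'a \<Rightarrow> real" where
  "metric x \<xi> \<eta> = dd (dd e (0, \<xi>)) (0, \<eta>) x"

definition spray :: "'a \<times> 'a \<Rightarrow> 'a \<times> 'a" where
  "spray x = (snd x, F x)"

lemma diff1: "x \<in> U \<Longrightarrow> e differentiable (at x)"
  and diff2: "x \<in> U \<Longrightarrow> dd e a differentiable (at x)"
  and diff3: "x \<in> U \<Longrightarrow> dd (dd e a) b differentiable (at x)"
  by (blast intro: smooth_on_differentiable smooth_on_dd smooth)+

lemma metric_sym: "x \<in> U \<Longrightarrow> metric x \<xi> \<eta> = metric x \<eta> \<xi>"
  unfolding metric_def by (rule dd_commute[OF smooth open_dom])

lemma linear_metric: "x \<in> U \<Longrightarrow> linear (metric x \<xi>)"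
proof -
  assume x: "x \<in> U"
  have "linear ((\<lambda>v. dd (dd e (0, \<xi>)) v x) \<circ> Pair 0)"
    by (intro linear_compose linear_dd[OF diff2[OF x]]) (auto intro!: linearI)
  then show ?thesis by (simp add: metric_def[abs_def] o_def)
qed

lemma bilinear_metric:
  assumes x: "x \<in> U"
  shows "bilinear (metric x)"
proof -
  have "(\<lambda>\<xi>. metric x \<xi> \<eta>) = metric x \<eta>" for \<eta>
    by (rule ext) (rule metric_sym[OF x])
  then show ?thesis
    unfolding bilinear_def using linear_metric[OF x] by simp
qed

lemma dd_split: "f differentiable (at x) \<Longrightarrow> dd f (a, b) x = dd f (a, 0) x + dd f (0, b) x"
  using dd_add[of f x "(a, 0)" "(0, b)"] by simp

lemma euler_identity:
  assumes x: "x \<in> U"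
  shows "dd e (0, snd x) x = 2 * e x"
proof -
  obtain q u where [simp]: "x = (q, u)" by fastforce
  have xU: "(q, u) \<in> U" using x by simp
  have "((\<lambda>t. e (x + t *\<^sub>R (0, u))) has_real_derivative dd e (0, u) (x + 0 *\<^sub>R (0, u))) (at 0)"
    by (rule dd_along_line) (use diff1[OF x] in simp)
  then have 1: "((\<lambda>t. e (q, u + t *\<^sub>R u)) has_real_derivative dd e (0, u) x) (at 0)"
    by simp
  have 2: "((\<lambda>t. (1 + t)\<^sup>2 * e (q, u)) has_real_derivative 2 * e (q, u)) (at 0)"
    by (auto intro!: derivative_eq_intros)
  \<comment> \<open>Homogeneity is available for positive factors only, hence t > -1; this is a
    neighbourhood of 0, where the derivative is taken.\<close>
  have 3: "(1 + t)\<^sup>2 * e (q, u) = e (q, u + t *\<^sub>R u)" if "t \<in> {-1<..}" for t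
    using homogeneous[OF xU, of "1 + t"] that by (simp add: scaleR_add_left)
  have "((\<lambda>t. e (q, u + t *\<^sub>R u)) has_real_derivative 2 * e (q, u)) (at 0)"
    by (rule has_field_derivative_transform_within_open[OF 2 _ _ 3, where S = "{-1<..}"]) auto
  from DERIV_unique[OF 1 this] show ?thesis by simp
qed

text \<open>The second term arises because the direction (0, u) moves with the point. A vertical
  \<open>b\<close> gives g(T, .) = \<open>theta\<close>, a horizontal one the degree two of the
  q-derivatives of the energy.\<close>

lemma euler_identity_derivative:
  assumes x: "x \<in> U"
  shows "dd (dd e (0, snd x)) b x + dd e (0, snd b) x = 2 * dd e b x"
proof -
  have "((\<lambda>y. (0::'a, snd y::'a)) has_derivative (\<lambda>b. (0, snd b))) (at x)"
    by (auto intro!: derivative_eq_intros)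
  from has_derivative_dd_along_field[OF smooth open_dom x this]
  have 1: "((\<lambda>y. 2 * e y) has_derivative (\<lambda>b. dd (dd e (0, snd x)) b x + dd e (0, snd b) x)) (at x)"
    by (rule has_derivative_transform_within_open[OF _ open_dom x]) (rule euler_identity)
  have 2: "((\<lambda>y. 2 * e y) has_derivative (\<lambda>b. 2 * dd e b x)) (at x)"
    by (intro has_derivative_mult_right has_derivative_dd diff1 x)
  show ?thesis
    using fun_cong[OF has_derivative_unique[OF 1 2], of b] by simp
qed

lemma metric_velocity:
  assumes "x \<in> U"
  shows "metric x (snd x) \<eta> = dd e (0, \<eta>) x" "metric x \<eta> (snd x) = dd e (0, \<eta>) x"
  using euler_identity_derivative[OF assms, of "(0, \<eta>)"] metric_sym[OF assms]
  by (simp_all add: metric_def)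

text \<open>This makes k_0 = E the case K^0 of the formula for k_j.\<close>

lemma energy_metric: "x \<in> U \<Longrightarrow> e x = 1/2 * metric x (snd x) (snd x)"
  by (simp add: metric_velocity euler_identity)

lemma has_derivative_spray:
  assumes "x \<in> U"
  shows "(spray has_derivative (\<lambda>b. (snd b, dd F b x))) (at x)"
  unfolding spray_def[abs_def]
  by (intro has_derivative_Pair has_derivative_snd has_derivative_ident has_derivative_dd
      force_differentiable assms)

text \<open>The vertical derivative in direction \<xi> of the Euler-Lagrange equations. The spray
  (u, F) varies along \<xi> by (\<xi>, \<open>dd F (0, \<xi>) x\<close>), which produces the second
  and third terms.\<close>

lemma euler_lagrange_derivative:
  assumes x: "x \<in> U"
  shows "dd (\<lambda>y. metric y \<eta> \<xi>) (spray x) x + dd (dd e (0, \<eta>)) (\<xi>, 0) x + metric x \<eta> (dd F (0, \<xi>) x)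
    = dd (dd e (\<eta>, 0)) (0, \<xi>) x"
proof -
  have sm: "smooth_on (dd e (0, \<eta>)) U" by (rule smooth_on_dd[OF smooth])
  from has_derivative_dd_along_field[OF sm open_dom x has_derivative_spray[OF x]]
  have "(dd e (\<eta>, 0) has_derivative (\<lambda>b. dd (dd (dd e (0, \<eta>)) (spray x)) b x +
      dd (dd e (0, \<eta>)) (snd b, dd F b x) x)) (at x)"
    by (rule has_derivative_transform_within_open[OF _ open_dom x])
      (simp add: spray_def euler_lagrange)
  from dd_eqI[OF this, of "(0, \<xi>)"]
  have "dd (dd e (\<eta>, 0)) (0, \<xi>) x = dd (dd (dd e (0, \<eta>)) (spray x)) (0, \<xi>) x +
      dd (dd e (0, \<eta>)) (\<xi>, dd F (0, \<xi>) x) x" by simp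
  \<comment> \<open>With the spray frozen at its value at \<open>x\<close>, symmetry of second
    derivatives exchanges it with the vertical direction \<xi>.\<close>
  moreover have "dd (dd (dd e (0, \<eta>)) (spray x)) (0, \<xi>) x = dd (\<lambda>y. metric y \<eta> \<xi>) (spray x) x"
    unfolding metric_def using dd_commute[OF sm open_dom x, of "spray x" "(0, \<xi>)"] by simp
  ultimately show ?thesis
    using dd_split[OF diff2[OF x], of "(0, \<eta>)" \<xi> "dd F (0, \<xi>) x"] by (simp add: metric_def)
qed

text \<open>Adding \<open>euler_lagrange_derivative\<close> for (\<eta>, \<xi>) and for (\<xi>,
  \<eta>) cancels the mixed q-u derivatives. Since the connection is -1/2 times the vertical
  derivative of \<open>F\<close>, the result reads \<nabla>g = 0.\<close>

lemma metric_parallel: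
  assumes x: "x \<in> U"
  shows "dd (\<lambda>y. metric y \<eta> \<xi>) (spray x) x =
    - (metric x \<eta> (dd F (0, \<xi>) x) + metric x \<xi> (dd F (0, \<eta>) x)) / 2"
proof -
  have "dd (\<lambda>y. metric y \<eta> \<xi>) (spray x) x = dd (\<lambda>y. metric y \<xi> \<eta>) (spray x) x"
    by (rule dd_cong[OF open_dom x]) (rule metric_sym)
  then show ?thesis
    using euler_lagrange_derivative[OF x, of \<eta> \<xi>] euler_lagrange_derivative[OF x, of \<xi> \<eta>]
      dd_commute[OF smooth open_dom x, of "(0, \<eta>)" "(\<xi>, 0)"]
      dd_commute[OF smooth open_dom x, of "(0, \<xi>)" "(\<eta>, 0)"]
    by (simp add: field_simps)
qed

text \<open>Equivalent to \<nabla>T = 0: applied to the velocity, the connection -1/2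
  \<open>dd F (0, _) x\<close> gives - \<open>F x\<close>, while \<open>F x\<close> is the change of
  the velocity along the spray. The identity is tested against every \<eta> in the metric, and
  nondegeneracy removes \<eta>.\<close>

lemma force_homogeneous:
  assumes x: "x \<in> U"
  shows "dd F (0, snd x) x = 2 *\<^sub>R F x"
proof -
  have "metric x \<eta> (dd F (0, snd x) x) = 2 * metric x \<eta> (F x)" for \<eta>
  proof -
    have sm: "smooth_on (dd e (0, \<eta>)) U" by (rule smooth_on_dd[OF smooth])
    have "((\<lambda>y. (0::'a, snd y::'a)) has_derivative (\<lambda>b. (0, snd b))) (at x)"
      by (auto intro!: derivative_eq_intros)
    from has_derivative_dd_along_field[OF sm open_dom x this]
    have "(dd e (0, \<eta>) has_derivative (\<lambda>b. dd (dd (dd e (0, \<eta>)) (0, snd x)) b x +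
        dd (dd e (0, \<eta>)) (0, snd b) x)) (at x)"
      by (rule has_derivative_transform_within_open[OF _ open_dom x])
        (use metric_velocity in \<open>simp add: metric_def\<close>)
    from dd_eqI[OF this, of "spray x"]
    \<comment> \<open>Obtained by differentiating
      \<open>dd e (0, \<eta>) y = metric y \<eta> (snd y)\<close> along the spray; the moving
      velocity contributes the term with \<open>F x\<close>.\<close>
    have 1: "dd e (\<eta>, 0) x = dd (\<lambda>y. metric y \<eta> (snd x)) (spray x) x + metric x \<eta> (F x)"
      using euler_lagrange[OF x, of \<eta>] by (simp add: metric_def spray_def)
    have 2: "dd e (\<eta>, 0) x = dd (dd e (0, \<eta>)) (snd x, 0) x + metric x \<eta> (F x)"
      using euler_lagrange[OF x, of \<eta>] dd_split[OF diff2[OF x], of "(0, \<eta>)" "snd x" "F x"]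
      by (simp add: metric_def)
    \<comment> \<open>The q-derivatives of the energy are homogeneous of degree two in u.\<close>
    have 3: "dd (dd e (\<eta>, 0)) (0, snd x) x = 2 * dd e (\<eta>, 0) x"
      using euler_identity_derivative[OF x, of "(\<eta>, 0)"] linear_0[OF linear_dd[OF diff1[OF x]]]
        dd_commute[OF smooth open_dom x, of "(\<eta>, 0)" "(0, snd x)"]
      by (simp add: zero_prod_def)
    show ?thesis
      using euler_lagrange_derivative[OF x, of \<eta> "snd x"] 1 2 3 by linarith
  qed
  then have "metric x \<eta> (dd F (0, snd x) x - 2 *\<^sub>R F x) = 0" for \<eta>
    using linear_metric[OF x, of \<eta>] by (simp add: linear_diff linear_cmul)
  then have "dd F (0, snd x) x - 2 *\<^sub>R F x = 0"
    using nondegenerate[OF x] metric_sym[OF x] by (metis metric_def)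
  then show ?thesis by simp
qed

end


section \<open>Directional derivatives of sums, products and linear images\<close>

lemma dd_bounded_linear:
  assumes "bounded_linear L" "f differentiable (at x)"
  shows "dd (\<lambda>y. L (f y)) v x = L (dd f v x)"
  by (rule dd_eqI[OF bounded_linear.has_derivative[OF assms(1) has_derivative_dd[OF assms(2)]]])

lemma differentiable_bounded_linear:
  assumes "bounded_linear L" "f differentiable (at x)"
  shows "(\<lambda>y. L (f y)) differentiable (at x)"
  using bounded_linear.has_derivative[OF assms(1) has_derivative_dd[OF assms(2)]]
    differentiableI by blast

lemma dd_bounded_bilinear:
  assumes "bounded_bilinear pr" "f differentiable (at x)" "g differentiable (at x)"
  shows "dd (\<lambda>y. pr (f y) (g y)) v x = pr (f x) (dd g v x) + pr (dd f v x) (g x)"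
  by (rule dd_eqI[OF bounded_bilinear.FDERIV[OF assms(1) has_derivative_dd[OF assms(2)]
          has_derivative_dd[OF assms(3)]]])

lemma differentiable_bounded_bilinear:
  assumes "bounded_bilinear pr" "f differentiable (at x)" "g differentiable (at x)"
  shows "(\<lambda>y. pr (f y) (g y)) differentiable (at x)"
  using bounded_bilinear.FDERIV[OF assms(1) has_derivative_dd[OF assms(2)]
      has_derivative_dd[OF assms(3)]] differentiableI by blast

lemma dd_sum:
  assumes "\<And>i. i \<in> I \<Longrightarrow> f i differentiable (at x)"
  shows "dd (\<lambda>y. \<Sum>i\<in>I. f i y) v x = (\<Sum>i\<in>I. dd (f i) v x)"
  by (rule dd_eqI[OF has_derivative_sum]) (rule has_derivative_dd[OF assms])

lemma dd_const [simp]: "dd (\<lambda>y. c) v x = 0"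
  by (rule dd_eqI[OF has_derivative_const])

lemmas dd_mult = dd_bounded_bilinear[OF bounded_bilinear_mult]

section \<open>The exponential recursion\<close>

definition exp_coeff :: "(nat \<Rightarrow> real) \<Rightarrow> nat \<Rightarrow> real" where
  "exp_coeff a n = (if n = 0 then 1 else phi_seq a n - a n)"

text \<open>Coefficient n - 1 of dB/dt = - B dA/dt. In the sum on the right the term i = 0 gives n
  a_n; in the others b_i = \<phi>_i - a_i separates the two sums in the recursion for
  \<phi>.\<close>

lemma exp_coeff_recursion:
  assumes n: "n > 0"
  shows "real n * exp_coeff a n = - (\<Sum>i<n. exp_coeff a i * (real (n - i) * a (n - i)))"
proof (cases "n = 1")
  case True
  then show ?thesis by (simp add: exp_coeff_def phi_seq.simps)
next
  case False
  then have n2: "n \<ge> 2" using n by simp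
  \<comment> \<open>Exchanging i and n - i averages the weights n - i and i to n/2; this is the
    origin of the factor 1/2 in the recursion for \<phi>.\<close>
  have sym: "(\<Sum>i=1..n-1. real (n - i) * a i * a (n - i)) = real n / 2 * (\<Sum>i=1..n-1. a i * a (n - i))"
  proof -
    have "(\<Sum>i=1..n-1. real (n - i) * a i * a (n - i)) = (\<Sum>i=1..n-1. real i * a i * a (n - i))"
      by (rule sum.reindex_bij_witness[of _ "\<lambda>i. n - i" "\<lambda>i. n - i"]) auto
    then have "2 * (\<Sum>i=1..n-1. real (n - i) * a i * a (n - i)) =
        (\<Sum>i=1..n-1. real (n - i) * a i * a (n - i) + real i * a i * a (n - i))"
      by (simp add: sum.distrib)
    also have "\<dots> = (\<Sum>i=1..n-1. real n * (a i * a (n - i)))"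
      by (rule sum.cong) (auto simp: of_nat_diff algebra_simps)
    finally show ?thesis by (simp only: sum_distrib_left[symmetric])
  qed
  have phi1: "phi_seq a (Suc 0) = 0" by (simp add: phi_seq.simps)
  \<comment> \<open>Since \<phi>_1 = 0, the sum over \<phi> may start at 1 as well.\<close>
  have ivl: "{1..n-1} = insert 1 {2..n-1}" using n2 by auto
  have "(\<Sum>i=1..n-1. real (n - i) * phi_seq a i * a (n - i)) =
      (\<Sum>i=2..n-1. real (n - i) * phi_seq a i * a (n - i))"
    unfolding ivl by (simp add: phi1)
  moreover have "real n * phi_seq a n = real n / 2 * (\<Sum>i=1..n-1. a i * a (n - i)) -
      (\<Sum>i=2..n-1. real (n - i) * phi_seq a i * a (n - i))"
    using n2 by (subst phi_seq.simps) (simp add: right_diff_distrib)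
  ultimately have 1: "real n * phi_seq a n = (\<Sum>i=1..n-1. real (n - i) * a i * a (n - i)) -
      (\<Sum>i=1..n-1. real (n - i) * phi_seq a i * a (n - i))"
    using sym by simp
  have ivl0: "{..<n} = insert 0 {1..n-1}" using n by auto
  have "(\<Sum>i<n. exp_coeff a i * (real (n - i) * a (n - i))) = real n * a n +
      (\<Sum>i=1..n-1. exp_coeff a i * (real (n - i) * a (n - i)))"
    unfolding ivl0 by (simp add: exp_coeff_def)
  also have "(\<Sum>i=1..n-1. exp_coeff a i * (real (n - i) * a (n - i))) =
      (\<Sum>i=1..n-1. real (n - i) * phi_seq a i * a (n - i) - real (n - i) * a i * a (n - i))"
    by (rule sum.cong) (auto simp: exp_coeff_def algebra_simps)
  finally show ?thesis
    using 1 n by (simp add: sum_subtractf exp_coeff_def right_diff_distrib)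
qed

lemma phi_seq_differentiable:
  assumes "\<And>j. j > 0 \<Longrightarrow> a j differentiable (at x)"
  shows "(\<lambda>y. phi_seq (\<lambda>j. a j y) n) differentiable (at x)"
proof (induction n rule: less_induct)
  case (less n)
  show ?case
  proof (cases "n \<le> 1")
    case True
    then show ?thesis by (simp add: phi_seq.simps)
  next
    case False
    then have "(\<lambda>y. phi_seq (\<lambda>j. a j y) n) = (\<lambda>y. 1/2 * (\<Sum>i = 1..n - 1. a i y * a (n - i) y) -
       1 / real n * (\<Sum>i = 2..n - 1. real (n - i) * phi_seq (\<lambda>j. a j y) i * a (n - i) y))"
      by (subst phi_seq.simps) simp
    moreover have "\<dots> differentiable (at x)"
      using False
      by (intro differentiable_diff differentiable_mult differentiable_sum differentiable_const)
        (auto intro!: differentiable_mult assms less.IH)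
    ultimately show ?thesis by simp
  qed
qed

lemma exp_coeff_differentiable:
  assumes "\<And>j. j > 0 \<Longrightarrow> a j differentiable (at x)"
  shows "(\<lambda>y. exp_coeff (\<lambda>j. a j y) n) differentiable (at x)"
  by (cases "n = 0") (auto simp: exp_coeff_def intro!: differentiable_diff phi_seq_differentiable assms)

text \<open>\<open>exp_coeff\<close> lists the coefficients of \<open>B = exp (- A)\<close>. With primes for derivatives in the direction
  \<open>v\<close>, both \<open>B' + B A'\<close> and \<open>B\<close> solve \<open>dX/dt = - X dA/dt\<close> in the formal variable \<open>t\<close>, and the former
  has no constant term.\<close>

lemma dd_exp_coeff:
  fixes a :: "nat \<Rightarrow> 'm::real_normed_vector \<Rightarrow> real"
  assumes diff: "\<And>j. j > 0 \<Longrightarrow> a j differentiable (at x)"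
  shows "dd (\<lambda>y. exp_coeff (\<lambda>j. a j y) n) v x =
    - (\<Sum>i<n. exp_coeff (\<lambda>j. a j x) i * dd (a (n - i)) v x)"
proof -
  define b where "b i y = exp_coeff (\<lambda>j. a j y) i" for i y
  have bdiff: "b i differentiable (at x)" for i
    unfolding b_def[abs_def] by (rule exp_coeff_differentiable) (rule diff)
  have rec: "real n * b n y = - (\<Sum>i<n. b i y * (real (n - i) * a (n - i) y))" if "n > 0" for n y
    unfolding b_def by (rule exp_coeff_recursion[OF that])
  have rec': "real n * dd (b n) v x = - (\<Sum>i<n. b i x * (real (n - i) * dd (a (n - i)) v x) +
       dd (b i) v x * (real (n - i) * a (n - i) x))" if n: "n > 0" for n
  proof -
    have "real n * dd (b n) v x = dd (\<lambda>y. real n * b n y) v x"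
      by (rule dd_bounded_linear[OF bounded_linear_mult_right bdiff, symmetric])
    also have "\<dots> = dd (\<lambda>y. - (\<Sum>i<n. b i y * (real (n - i) * a (n - i) y))) v x"
      using rec[OF n] by simp
    also have "\<dots> = - dd (\<lambda>y. \<Sum>i<n. b i y * (real (n - i) * a (n - i) y)) v x"
      by (rule dd_bounded_linear[OF bounded_linear_minus[OF bounded_linear_ident]])
        (auto intro!: differentiable_sum differentiable_mult bdiff diff)
    also have "dd (\<lambda>y. \<Sum>i<n. b i y * (real (n - i) * a (n - i) y)) v x =
        (\<Sum>i<n. dd (\<lambda>y. b i y * (real (n - i) * a (n - i) y)) v x)"
      by (rule dd_sum) (auto intro!: differentiable_mult bdiff diff)
    also have "\<dots> = (\<Sum>i<n. b i x * (real (n - i) * dd (a (n - i)) v x) +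
       dd (b i) v x * (real (n - i) * a (n - i) x))"
    proof (rule sum.cong)
      fix i assume "i \<in> {..<n}"
      then have d: "a (n - i) differentiable (at x)" by (auto intro: diff)
      show "dd (\<lambda>y. b i y * (real (n - i) * a (n - i) y)) v x =
          b i x * (real (n - i) * dd (a (n - i)) v x) + dd (b i) v x * (real (n - i) * a (n - i) x)"
        using d by (subst dd_mult) (auto intro!: bdiff differentiable_mult
            simp: dd_bounded_linear[OF bounded_linear_mult_right])
    qed simp
    finally show ?thesis .
  qed
  define A where "A = Abs_fps (\<lambda>i. a i x)"
  \<comment> \<open>Differentiability is given for positive indices only, so the constant
    coefficient is set to 0; the \<open>a 0\<close> in \<open>A\<close> disappears under
    \<open>fps_deriv\<close>.\<close>
  define A' where "A' = Abs_fps (\<lambda>i. if i = 0 then 0 else dd (a i) v x)"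
  define B where "B = Abs_fps (\<lambda>i. b i x)"
  define B' where "B' = Abs_fps (\<lambda>i. dd (b i) v x)"
  have B: "fps_deriv B = - (B * fps_deriv A)"
  proof (rule fps_ext)
    fix n
    show "fps_nth (fps_deriv B) n = fps_nth (- (B * fps_deriv A)) n"
      using rec[of "Suc n" x]
      by (simp add: B_def A_def fps_mult_nth atLeast0AtMost lessThan_Suc_atMost Suc_diff_le)
  qed
  have B': "fps_deriv B' = - (B * fps_deriv A' + B' * fps_deriv A)"
  proof (rule fps_ext)
    fix n
    show "fps_nth (fps_deriv B') n = fps_nth (- (B * fps_deriv A' + B' * fps_deriv A)) n"
      using rec'[of "Suc n"]
      by (simp add: B_def A_def B'_def A'_def fps_mult_nth atLeast0AtMost lessThan_Suc_atMost
          Suc_diff_le sum.distrib)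
  qed
  define C where "C = B' + B * A'"
  have C: "fps_deriv C = - (C * fps_deriv A)"
    unfolding C_def by (simp add: B B' algebra_simps)
  have C0: "fps_nth C 0 = 0"
    by (simp add: C_def B'_def A'_def b_def[abs_def] exp_coeff_def)
  have "fps_nth C n = 0" for n
  proof (induction n rule: less_induct)
    case (less n)
    show ?case
    proof (cases n)
      case (Suc m)
      \<comment> \<open>The equation for \<open>C\<close> expresses each coefficient through earlier
        ones, which vanish by induction.\<close>
      have "real (Suc m) * fps_nth C (Suc m) = fps_nth (fps_deriv C) m" by simp
      also have "\<dots> = 0"
        unfolding C fps_neg_nth fps_mult_nth using less Suc by simp
      finally show ?thesis using Suc by simp
    qed (use C0 in simp)
  qed
  then have "fps_nth B' n = - fps_nth (B * A') n"
    by (simp add: C_def eq_neg_iff_add_eq_0)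
  also have "fps_nth (B * A') n = (\<Sum>i\<le>n. b i x * (if n - i = 0 then 0 else dd (a (n - i)) v x))"
    by (simp add: fps_mult_nth B_def A'_def atLeast0AtMost)
  also have "\<dots> = (\<Sum>i<n. b i x * dd (a (n - i)) v x)"
    by (simp add: lessThan_Suc_atMost[symmetric])
  finally show ?thesis
    by (simp add: B'_def b_def[abs_def])
qed

text \<open>The product rule for B k: the hypotheses say B' = - B C and k' = k C, so the two
  contributions cancel. Sums over i < n mean that \<open>C\<close> has constant term 0.\<close>

lemma fps_convolution_cancel:
  fixes b k c :: "nat \<Rightarrow> real"
  assumes b': "\<And>n. b' n = - (\<Sum>i<n. b i * c (n - i))"
    and k': "\<And>n. k' n = (\<Sum>i<n. k i * c (n - i))"
  shows "(\<Sum>i\<le>n. b i * k' (n - i) + b' i * k (n - i)) = 0"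
proof -
  define C where "C = Abs_fps (\<lambda>i. if i = 0 then 0 else c i)"
  have conv: "(\<Sum>i<n. f i * c (n - i)) = fps_nth (Abs_fps f * C) n" for f n
  proof -
    have "fps_nth (Abs_fps f * C) n = (\<Sum>i\<le>n. f i * (if n - i = 0 then 0 else c (n - i)))"
      by (simp add: fps_mult_nth C_def atLeast0AtMost)
    also have "\<dots> = (\<Sum>i<n. f i * c (n - i))"
      by (simp add: lessThan_Suc_atMost[symmetric])
    finally show ?thesis by simp
  qed
  have 1: "Abs_fps b' = - (Abs_fps b * C)" "Abs_fps k' = Abs_fps k * C"
    by (rule fps_ext, simp only: fps_nth_Abs_fps b' k' conv fps_neg_nth)+
  have "(\<Sum>i\<le>n. b i * k' (n - i) + b' i * k (n - i)) =
      fps_nth (Abs_fps b * Abs_fps k' + Abs_fps b' * Abs_fps k) n"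
    by (simp add: fps_mult_nth sum.distrib atLeast0AtMost)
  also have "\<dots> = 0"
    unfolding 1 by (simp add: algebra_simps)
  finally show ?thesis .
qed


section \<open>Derivatives of matrix powers\<close>

lemma bounded_bilinear_matrix_mult:
  "bounded_bilinear ((**) :: real^'n^'n \<Rightarrow> real^'n^'n \<Rightarrow> real^'n^'n)"
  unfolding bilinear_conv_bounded_bilinear[symmetric] bilinear_def
  by (auto intro!: linearI
      simp: matrix_matrix_mult_def vec_eq_iff sum.distrib sum_distrib_left algebra_simps)

lemma bounded_bilinear_matrix_vector_mult:
  "bounded_bilinear ((*v) :: real^'n^'n \<Rightarrow> real^'n \<Rightarrow> real^'n)"
  unfolding bilinear_conv_bounded_bilinear[symmetric] bilinear_def
  by (auto intro!: linearI
      simp: matrix_vector_mult_def vec_eq_iff sum.distrib sum_distrib_left algebra_simps)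

lemma linear_trace: "linear (trace :: real^'n^'n \<Rightarrow> real)"
  by (auto intro!: linearI simp: trace_def sum.distrib sum_distrib_left)

lemmas bounded_linear_trace = linear_trace[unfolded linear_conv_bounded_linear]

interpretation matrix_mult: bounded_bilinear "(**) :: real^'n^'n \<Rightarrow> real^'n^'n \<Rightarrow> real^'n^'n"
  by (rule bounded_bilinear_matrix_mult)

interpretation matrix_vector_mult: bounded_bilinear "(*v) :: real^'n^'n \<Rightarrow> real^'n \<Rightarrow> real^'n"
  by (rule bounded_bilinear_matrix_vector_mult)

lemmas matrix_simps = matrix_mult.add_left matrix_mult.add_right matrix_mult.diff_left
  matrix_mult.diff_right matrix_mult.minus_left matrix_mult.minus_right matrix_mult.scaleR_left
  matrix_mult.scaleR_right matrix_vector_mult.add_left matrix_vector_mult.add_right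
  matrix_vector_mult.diff_left matrix_vector_mult.diff_right matrix_vector_mult.minus_left
  matrix_vector_mult.minus_right matrix_vector_mult.scaleR_left matrix_vector_mult.scaleR_right
  linear_add[OF linear_trace] linear_diff[OF linear_trace] linear_neg[OF linear_trace]
  linear_cmul[OF linear_trace]

definition mpow :: "real^'n^'n \<Rightarrow> nat \<Rightarrow> real^'n^'n" where
  "mpow K j = (((**) K) ^^ j) (mat 1)"

lemma mpow_0 [simp]: "mpow K 0 = mat 1"
  and mpow_Suc: "mpow K (Suc j) = K ** mpow K j"
  by (simp_all add: mpow_def)

lemma mpow_Suc2: "mpow K (Suc j) = mpow K j ** K"
proof (induction j)
  case (Suc j)
  then show ?case by (metis matrix_mul_assoc mpow_Suc)
qed (simp add: mpow_Suc)

lemma mpow_add: "mpow K (i + j) = mpow K i ** mpow K j"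
  by (induction i) (simp_all add: mpow_Suc matrix_mul_assoc)

lemma mpow_differentiable: "K differentiable (at x) \<Longrightarrow> (\<lambda>y. mpow (K y) j) differentiable (at x)"
  by (induction j)
    (auto simp: mpow_Suc intro: differentiable_bounded_bilinear[OF bounded_bilinear_matrix_mult])

text \<open>The derivative of \<open>K^j\<close> in the direction \<open>S\<close>; the commutator \<open>K N - N K\<close> only produces
  the commutator of \<open>K^j\<close> with \<open>N\<close>.\<close>

definition mpow_deriv :: "real^'n^'n \<Rightarrow> real^'n^'n \<Rightarrow> nat \<Rightarrow> real^'n^'n" where
  "mpow_deriv K S j = (\<Sum>i<j. mpow K i ** S ** mpow K (j - 1 - i))"

lemma mpow_deriv_Suc: "mpow_deriv K S (Suc j) = S ** mpow K j + K ** mpow_deriv K S j"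
  unfolding mpow_deriv_def
  by (simp add: sum.lessThan_Suc_shift matrix_mult.sum_right mpow_Suc matrix_mul_assoc
      del: sum.lessThan_Suc)

text \<open>M ** N - N ** M is a derivation in M, so it passes from K to K^j as it stands; only
  \<open>S\<close> is spread over the factors.\<close>

lemma dd_mpow:
  fixes K :: "'m::real_normed_vector \<Rightarrow> real^'n^'n"
  assumes diff: "K differentiable (at x)"
    and dK: "dd K v x = K x ** N - N ** K x + S"
  shows "dd (\<lambda>y. mpow (K y) j) v x = mpow (K x) j ** N - N ** mpow (K x) j + mpow_deriv (K x) S j"
proof (induction j)
  case 0
  then show ?case by (simp add: mpow_deriv_def)
next
  case (Suc j)
  have "dd (\<lambda>y. mpow (K y) (Suc j)) v x =
      K x ** dd (\<lambda>y. mpow (K y) j) v x + dd K v x ** mpow (K x) j"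
    unfolding mpow_Suc
    by (rule dd_bounded_bilinear[OF bounded_bilinear_matrix_mult diff mpow_differentiable[OF diff]])
  then show ?case
    unfolding Suc dK mpow_deriv_Suc mpow_Suc
    by (simp add: matrix_simps matrix_mul_assoc)
qed

text \<open>Cyclicity makes all \<open>j\<close> summands equal, and the resulting factor
  \<open>j\<close> cancels the 1/j in a_j.\<close>

lemma trace_mpow_deriv: "trace (mpow_deriv K S j) = real j * trace (mpow K (j - 1) ** S)"
proof -
  have "trace (mpow K i ** S ** mpow K (j - 1 - i)) = trace (mpow K (j - 1) ** S)" if "i < j" for i
  proof -
    have "trace (mpow K i ** S ** mpow K (j - 1 - i)) = trace (mpow K (j - 1 - i) ** (mpow K i ** S))"
      by (rule trace_mul_sym)
    also have "\<dots> = trace (mpow K (j - 1 - i + i) ** S)"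
      by (simp only: matrix_mul_assoc mpow_add)
    finally show ?thesis using that by simp
  qed
  then show ?thesis
    unfolding mpow_deriv_def
    by (simp add: linear_sum[OF linear_trace])
qed

lemma trace_mul_outer:
  fixes M :: "real^'n^'n"
  shows "trace (M ** (\<chi> i j. u $ i * w $ j)) = w \<bullet> (M *v u)"
proof -
  have "trace (M ** (\<chi> i j. u $ i * w $ j)) = (\<Sum>i\<in>UNIV. \<Sum>k\<in>UNIV. M $ i $ k * (u $ k * w $ i))"
    by (simp add: trace_def matrix_matrix_mult_def)
  also have "\<dots> = (\<Sum>i\<in>UNIV. w $ i * (\<Sum>k\<in>UNIV. M $ i $ k * u $ k))"
    by (simp add: sum_distrib_left algebra_simps)
  finally show ?thesis by (simp add: inner_vec_def matrix_vector_mult_def)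
qed

lemma outer_vector_mult: "(\<chi> i j. u $ i * w $ j) *v v = (w \<bullet> v) *\<^sub>R (u :: real^'n)"
  by (simp add: matrix_vector_mult_def vec_eq_iff inner_vec_def sum_distrib_left mult_ac)

text \<open>All objects in the coordinates of one chart: \<open>N\<close> is the matrix of connection coefficients,
  and \<open>v\<close> the value of the spray at \<open>x\<close>.\<close>

locale special_tensor_at =
  fixes G K :: "'m::real_normed_vector \<Rightarrow> real^'n^'n" and T :: "'m \<Rightarrow> real^'n"
    and x v :: 'm and N :: "real^'n^'n" and X :: "real^'n"
  assumes diff: "G differentiable (at x)" "K differentiable (at x)" "T differentiable (at x)"
    and metric_transpose: "transpose (G x) = G x"
    and self_adjoint: "transpose (K x) ** G x = G x ** K x"
    and dd_metric: "dd G v x = transpose N ** G x + G x ** N"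
    and dd_velocity: "dd T v x = - (N *v T x)"
    and dd_tensor: "dd K v x = K x ** N - N ** K x +
      (-1/2) *\<^sub>R ((\<chi> i j. T x $ i * (G x *v X) $ j) + (\<chi> i j. X $ i * (G x *v T x) $ j))"
begin

text \<open>This is \<nabla>K in the chart. The 1-form is eliminated by \<alpha> = - g(X, .), which
  turns the difference in the hypothesis into minus a sum symmetric in T and X.\<close>

definition S :: "real^'n^'n" where
  "S = (-1/2) *\<^sub>R ((\<chi> i j. T x $ i * (G x *v X) $ j) + (\<chi> i j. X $ i * (G x *v T x) $ j))"

definition g :: "real^'n \<Rightarrow> real^'n \<Rightarrow> real" where
  "g a b = a \<bullet> (G x *v b)"

text \<open>Without the case distinction of \<open>k_fun\<close>: at j = 0 the formula gives the
  energy.\<close>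

definition kk :: "nat \<Rightarrow> 'm \<Rightarrow> real" where
  "kk j y = 1/2 * (T y \<bullet> (G y *v (mpow (K y) j *v T y)))"

definition aa :: "nat \<Rightarrow> 'm \<Rightarrow> real" where
  "aa j y = 1 / real j * trace (mpow (K y) j)"

lemma g_sym: "g a b = g b a"
  unfolding g_def by (metis dot_lmul_matrix inner_commute metric_transpose transpose_matrix_vector)

lemma g_self_adjoint: "g (K x *v a) b = g a (K x *v b)"
proof -
  have "g (K x *v a) b = a \<bullet> ((transpose (K x) ** G x) *v b)"
    unfolding g_def
    by (metis dot_lmul_matrix inner_commute matrix_vector_mul_assoc transpose_matrix_vector)
  then show ?thesis
    unfolding self_adjoint g_def by (simp add: matrix_vector_mul_assoc)
qed

lemma g_mpow_self_adjoint: "g (mpow (K x) j *v a) b = g a (mpow (K x) j *v b)"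
proof (induction j arbitrary: a b)
  case (Suc j)
  have "g (mpow (K x) (Suc j) *v a) b = g (mpow (K x) j *v a) (K x *v b)"
    by (simp only: mpow_Suc matrix_vector_mul_assoc[symmetric] g_self_adjoint)
  then show ?case
    by (simp only: Suc mpow_Suc2 matrix_vector_mul_assoc[symmetric])
qed simp

lemma S_mult: "S *v w = (-1/2) *\<^sub>R (g X w *\<^sub>R T x + g (T x) w *\<^sub>R X)"
proof -
  have "(G x *v a) \<bullet> w = g a w" for a
    using g_sym[of a w] by (simp add: g_def inner_commute)
  then show ?thesis
    unfolding S_def
    by (simp add: matrix_simps outer_vector_mult)
qed

text \<open>The trace kills the commutator with \<open>N\<close>. Of the term with \<open>S\<close>
  two pairings of T and X through K^(j-1) remain; they agree because K^(j-1) is self-adjoint, and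
  this cancels the factor 1/2.\<close>

lemma dd_aa:
  assumes j: "j > 0"
  shows "dd (aa j) v x = - g X (mpow (K x) (j - 1) *v T x)"
proof -
  let ?P = "mpow (K x) (j - 1)"
  have "dd (aa j) v x = 1 / real j * dd (\<lambda>y. trace (mpow (K y) j)) v x"
    unfolding aa_def[abs_def]
    by (rule dd_bounded_linear[OF bounded_linear_mult_right])
      (rule differentiable_bounded_linear[OF bounded_linear_trace mpow_differentiable[OF diff(2)]])
  also have "dd (\<lambda>y. trace (mpow (K y) j)) v x = trace (dd (\<lambda>y. mpow (K y) j) v x)"
    by (rule dd_bounded_linear[OF bounded_linear_trace mpow_differentiable[OF diff(2)]])
  also have "dd (\<lambda>y. mpow (K y) j) v x = mpow (K x) j ** N - N ** mpow (K x) j + mpow_deriv (K x) S j"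
    by (rule dd_mpow[OF diff(2)]) (simp add: dd_tensor S_def)
  also have "trace \<dots> = real j * trace (?P ** S)"
    by (simp add: matrix_simps trace_mul_sym[of "mpow (K x) j" N] trace_mpow_deriv)
  also have "trace (?P ** S) = -1/2 * (g X (?P *v T x) + g (T x) (?P *v X))"
  proof -
    have "(G x *v a) \<bullet> w = g a w" for a w
      using g_sym[of a w] by (simp add: g_def inner_commute)
    then show ?thesis
      unfolding S_def by (simp add: matrix_simps trace_mul_outer)
  qed
  also have "g (T x) (?P *v X) = g X (?P *v T x)"
    by (metis g_mpow_self_adjoint g_sym)
  finally show ?thesis using j by simp
qed

lemma aa_differentiable: "aa j differentiable (at x)"
  unfolding aa_def[abs_def]
  by (intro differentiable_mult differentiable_const
      differentiable_bounded_linear[OF bounded_linear_trace] mpow_differentiable diff)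

lemmas diff_mult_vector = differentiable_bounded_bilinear[OF bounded_bilinear_matrix_vector_mult]
lemmas dd_mult_vector = dd_bounded_bilinear[OF bounded_bilinear_matrix_vector_mult]

lemma kk_differentiable: "kk j differentiable (at x)"
  unfolding kk_def[abs_def]
  by (intro differentiable_mult differentiable_const diff_mult_vector mpow_differentiable diff
      differentiable_bounded_bilinear[OF bounded_bilinear_inner])

text \<open>As the metric and the velocity are parallel, all terms with \<open>N\<close> cancel and
  g(T, D T) is left, where D is the part of the derivative of K^j that contains \<open>S\<close>.
  Moving K^i to the left factor reduces each summand to one application of \<open>S\<close>, a
  matrix of rank at most two.\<close>

lemma dd_kk: "dd (kk j) v x = (\<Sum>i<j. kk i x * dd (aa (j - i)) v x)"
proof -
  let ?P = "mpow (K x) j" and ?D = "mpow_deriv (K x) S j"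
  have dP: "dd (\<lambda>y. mpow (K y) j) v x = ?P ** N - N ** ?P + ?D"
    by (rule dd_mpow[OF diff(2)]) (simp add: dd_tensor S_def)
  have d: "(\<lambda>y. mpow (K y) j *v T y) differentiable (at x)"
    by (intro diff_mult_vector mpow_differentiable diff)
  have "dd (\<lambda>y. mpow (K y) j *v T y) v x = ?P *v (- (N *v T x)) + (?P ** N - N ** ?P + ?D) *v T x"
    unfolding dP[symmetric] dd_velocity[symmetric]
    by (intro dd_mult_vector mpow_differentiable diff)
  also have "\<dots> = - (N *v (?P *v T x)) + ?D *v T x"
    by (simp add: matrix_simps matrix_vector_mul_assoc)
  finally have 1: "dd (\<lambda>y. mpow (K y) j *v T y) v x = - (N *v (?P *v T x)) + ?D *v T x" .
  have "dd (\<lambda>y. G y *v (mpow (K y) j *v T y)) v x =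
      G x *v (- (N *v (?P *v T x)) + ?D *v T x) + (transpose N ** G x + G x ** N) *v (?P *v T x)"
    unfolding 1[symmetric] dd_metric[symmetric] by (intro dd_mult_vector d diff)
  also have "\<dots> = G x *v (?D *v T x) + transpose N *v (G x *v (?P *v T x))"
    by (simp add: matrix_simps matrix_vector_mul_assoc matrix_mul_assoc)
  finally have 2: "dd (\<lambda>y. G y *v (mpow (K y) j *v T y)) v x =
      G x *v (?D *v T x) + transpose N *v (G x *v (?P *v T x))" .
  have "dd (\<lambda>y. T y \<bullet> (G y *v (mpow (K y) j *v T y))) v x =
      T x \<bullet> (G x *v (?D *v T x) + transpose N *v (G x *v (?P *v T x))) +
      (- (N *v T x)) \<bullet> (G x *v (?P *v T x))"
    unfolding 2[symmetric] dd_velocity[symmetric]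
    by (intro dd_bounded_bilinear[OF bounded_bilinear_inner] diff_mult_vector d diff)
  also have "\<dots> = g (T x) (?D *v T x)"
  proof -
    have "T x \<bullet> (transpose N *v w) = (N *v T x) \<bullet> w" for w
      by (metis dot_lmul_matrix inner_commute transpose_matrix_vector)
    then show ?thesis by (simp add: g_def inner_add_right)
  qed
  also have "\<dots> = (\<Sum>i<j. g (T x) ((mpow (K x) i ** S ** mpow (K x) (j - 1 - i)) *v T x))"
    unfolding g_def mpow_deriv_def
    by (simp only: matrix_vector_mult.sum_left matrix_vector_mult.sum_right inner_sum_right)
  \<comment> \<open>Pairing T with K^i T in the metric gives 2 k_i, and this 2 absorbs the -1/2 in
    \<open>S\<close> up to sign.\<close>
  also have "\<dots> = (\<Sum>i<j. - (kk i x * g X (mpow (K x) (j - 1 - i) *v T x) +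
       kk (j - 1 - i) x * g X (mpow (K x) i *v T x)))"
  proof (rule sum.cong)
    fix i assume "i \<in> {..<j}"
    let ?A = "mpow (K x) i" and ?B = "mpow (K x) (j - 1 - i)"
    have "g (T x) ((?A ** S ** ?B) *v T x) = g (T x) (?A *v (S *v (?B *v T x)))"
      by (simp only: matrix_vector_mul_assoc[symmetric])
    also have "\<dots> = g (?A *v T x) (S *v (?B *v T x))"
      by (simp only: g_mpow_self_adjoint)
    also have "\<dots> = -1/2 * (g X (?B *v T x) * g (?A *v T x) (T x) +
        g (T x) (?B *v T x) * g (?A *v T x) X)"
      unfolding S_mult
      by (simp add: g_def matrix_simps inner_add_right algebra_simps)
    also have "\<dots> = - (kk i x * g X (?B *v T x) + kk (j - 1 - i) x * g X (?A *v T x))"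
      using g_sym[of "?A *v T x"] by (simp add: kk_def g_def algebra_simps)
    finally show "g (T x) ((?A ** S ** ?B) *v T x) =
        - (kk i x * g X (?B *v T x) + kk (j - 1 - i) x * g X (?A *v T x))" .
  qed simp
  \<comment> \<open>The two families of products are exchanged by the reflection i -> j - 1 -
    i.\<close>
  also have "\<dots> = - (2 * (\<Sum>i<j. kk i x * g X (mpow (K x) (j - 1 - i) *v T x)))"
  proof -
    have "(\<Sum>i<j. kk (j - 1 - i) x * g X (mpow (K x) i *v T x)) =
        (\<Sum>i<j. kk i x * g X (mpow (K x) (j - 1 - i) *v T x))"
      by (rule sum.reindex_bij_witness[of _ "\<lambda>i. j - 1 - i" "\<lambda>i. j - 1 - i"]) auto
    then show ?thesis by (simp only: sum.distrib sum_negf)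
  qed
  also have "\<dots> = 2 * (\<Sum>i<j. kk i x * dd (aa (j - i)) v x)"
    by (simp add: dd_aa sum_negf)
  finally have "1/2 * dd (\<lambda>y. T y \<bullet> (G y *v (mpow (K y) j *v T y))) v x =
      (\<Sum>i<j. kk i x * dd (aa (j - i)) v x)" by simp
  moreover have "dd (kk j) v x = 1/2 * dd (\<lambda>y. T y \<bullet> (G y *v (mpow (K y) j *v T y))) v x"
    unfolding kk_def[abs_def]
    by (rule dd_bounded_linear[OF bounded_linear_mult_right])
      (intro differentiable_bounded_bilinear[OF bounded_bilinear_inner] diff_mult_vector d diff)
  ultimately show ?thesis by simp
qed

text \<open>As \<open>exp_coeff\<close> is 1 at index 0, the sum is h_l written as one
  convolution.\<close>

lemma first_integral:
  "dd (\<lambda>y. \<Sum>i\<le>l. exp_coeff (\<lambda>j. aa j y) i * kk (l - i) y) v x = 0"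
proof -
  have ed: "(\<lambda>y. exp_coeff (\<lambda>j. aa j y) i) differentiable (at x)" for i
    by (rule exp_coeff_differentiable) (rule aa_differentiable)
  have "dd (\<lambda>y. \<Sum>i\<le>l. exp_coeff (\<lambda>j. aa j y) i * kk (l - i) y) v x =
      (\<Sum>i\<le>l. dd (\<lambda>y. exp_coeff (\<lambda>j. aa j y) i * kk (l - i) y) v x)"
    by (rule dd_sum) (intro differentiable_mult ed kk_differentiable)
  also have "\<dots> = (\<Sum>i\<le>l. exp_coeff (\<lambda>j. aa j x) i * dd (kk (l - i)) v x +
      dd (\<lambda>y. exp_coeff (\<lambda>j. aa j y) i) v x * kk (l - i) x)"
    by (rule sum.cong[OF refl], rule dd_mult) (intro ed kk_differentiable)+
  also have "\<dots> = 0"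
    by (rule fps_convolution_cancel[of _ _ "\<lambda>i. dd (aa i) v x"])
      (rule dd_exp_coeff[OF aa_differentiable] dd_kk)+
  finally show ?thesis .
qed

end


section \<open>Manifolds in coordinates\<close>

lemma Ck_on_cong:
  assumes "open S" "\<And>x. x \<in> S \<Longrightarrow> f x = g x" "Ck_on f S k"
  shows "Ck_on g S k"
  using assms(2,3)
proof (induction k arbitrary: f g)
  case 0
  then show ?case using continuous_on_cong[OF refl, of S f g] by simp
next
  case (Suc k)
  have eq: "frechet_derivative f (at x) = frechet_derivative g (at x)" if "x \<in> S" for x
    by (rule frechet_derivative_cong_open[OF assms(1) that Suc.prems(1)])
  have "g differentiable (at x)" if "x \<in> S" for x
  proof -
    have "(f has_derivative frechet_derivative f (at x)) (at x)"
      using Suc.prems(2) that by (simp add: frechet_derivative_works)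
    then have "(g has_derivative frechet_derivative f (at x)) (at x)"
      by (rule has_derivative_transform_within_open[OF _ assms(1) that Suc.prems(1)])
    then show ?thesis by (rule differentiableI)
  qed
  moreover have "Ck_on (\<lambda>x. frechet_derivative g (at x) e) S k" for e
    by (rule Suc.IH[of "\<lambda>x. frechet_derivative f (at x) e"]) (use Suc.prems eq in auto)
  ultimately show ?case by simp
qed

lemma Ck_on_SucD: "Ck_on f S (Suc k) \<Longrightarrow> Ck_on f S k"
proof (induction k arbitrary: f)
  case 0
  then show ?case
    by (auto intro!: continuous_at_imp_continuous_on differentiable_imp_continuous_within)
next
  case (Suc k)
  then show ?case by (metis Ck_on.simps(2))
qed

lemma Ck_on_add:
  assumes "open S" "Ck_on f S k" "Ck_on g S k"
  shows "Ck_on (\<lambda>x. f x + g x) S k"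
  using assms(2,3)
proof (induction k arbitrary: f g)
  case (Suc k)
  have "Ck_on (\<lambda>x. frechet_derivative (\<lambda>x. f x + g x) (at x) e) S k" for e
  proof (rule Ck_on_cong[OF assms(1)])
    show "Ck_on (\<lambda>x. frechet_derivative f (at x) e + frechet_derivative g (at x) e) S k"
      using Suc by simp
    show "frechet_derivative f (at x) e + frechet_derivative g (at x) e =
        frechet_derivative (\<lambda>x. f x + g x) (at x) e" if "x \<in> S" for x
      using dd_eqI[OF has_derivative_add[OF has_derivative_dd has_derivative_dd], of f x g e] Suc.prems that
      by (simp add: dd_def)
  qed
  then show ?case using Suc.prems by (simp add: differentiable_add)
qed (auto intro: continuous_on_add)

lemma Ck_on_mult:
  fixes f g :: "'a::real_normed_vector \<Rightarrow> real"
  assumes "open S" "Ck_on f S k" "Ck_on g S k"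
  shows "Ck_on (\<lambda>x. f x * g x) S k"
  using assms(2,3)
proof (induction k arbitrary: f g)
  case (Suc k)
  have "Ck_on (\<lambda>x. frechet_derivative (\<lambda>x. f x * g x) (at x) e) S k" for e
  proof (rule Ck_on_cong[OF assms(1)])
    show "Ck_on (\<lambda>x. f x * frechet_derivative g (at x) e + frechet_derivative f (at x) e * g x) S k"
      \<comment> \<open>The product rule multiplies a first derivative of one factor by the other
        factor itself, which must be lowered to class \<open>k\<close> first.\<close>
      using Suc.prems Suc.prems[THEN Ck_on_SucD]
      by (intro Ck_on_add[OF assms(1)] Suc.IH) simp_all
    show "f x * frechet_derivative g (at x) e + frechet_derivative f (at x) e * g x =
        frechet_derivative (\<lambda>x. f x * g x) (at x) e" if "x \<in> S" for x
      using dd_mult[of f x g e] Suc.prems that by (simp add: dd_def)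
  qed
  then show ?case using Suc.prems by (simp add: differentiable_mult)
qed (auto intro: continuous_on_mult)

lemma smooth_on_cong:
  "open S \<Longrightarrow> (\<And>x. x \<in> S \<Longrightarrow> f x = g x) \<Longrightarrow> smooth_on f S \<Longrightarrow> smooth_on g S"
  unfolding smooth_on_def using Ck_on_cong by metis

lemma smooth_on_mult:
  fixes f g :: "'a::real_normed_vector \<Rightarrow> real"
  shows "open S \<Longrightarrow> smooth_on f S \<Longrightarrow> smooth_on g S \<Longrightarrow> smooth_on (\<lambda>x. f x * g x) S"
  unfolding smooth_on_def using Ck_on_mult by metis

section \<open>Charts, Jacobians and tangent vectors\<close>

locale manifold =
  fixes M :: "'p topology" and A :: "('p, 'e::euclidean_space) chart set"
  assumes smooth_manifold: "smooth_manifold M A"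
begin

lemma chart_open: "c \<in> A \<Longrightarrow> openin M (fst c)" "c \<in> A \<Longrightarrow> open (snd c ` fst c)"
  and chart_homeo: "c \<in> A \<Longrightarrow>
    homeomorphic_map (subtopology M (fst c)) (top_of_set (snd c ` fst c)) (snd c)"
  and transition_smooth: "c \<in> A \<Longrightarrow> c' \<in> A \<Longrightarrow>
    smooth_on (transition c c') (snd c ` (fst c \<inter> fst c'))"
  using smooth_manifold unfolding smooth_manifold_def by auto

lemma chart_topspace: "c \<in> A \<Longrightarrow> topspace (subtopology M (fst c)) = fst c"
  by (rule topspace_subtopology_subset[OF openin_subset[OF chart_open(1)]])

lemma chart_inj: "c \<in> A \<Longrightarrow> inj_on (snd c) (fst c)"
  using homeomorphic_imp_injective_map[OF chart_homeo, of c] by (simp only: chart_topspace)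

lemma chart_inv_left: "c \<in> A \<Longrightarrow> p \<in> fst c \<Longrightarrow> chart_inv c (snd c p) = p"
  unfolding chart_inv_def by (rule inv_into_f_f[OF chart_inj])

lemma overlap_open:
  assumes "c \<in> A" "c' \<in> A"
  shows "open (snd c ` (fst c \<inter> fst c'))"
proof -
  have "openin (subtopology M (fst c)) (fst c \<inter> fst c')"
    using chart_open(1)[OF assms(2)] openin_subtopology by blast
  then have "openin (top_of_set (snd c ` fst c)) (snd c ` (fst c \<inter> fst c'))"
    using homeomorphic_imp_open_map[OF chart_homeo[OF assms(1)]] unfolding open_map_def by blast
  then show ?thesis
    using chart_open(2)[OF assms(1)] openin_open_trans by blast
qed

lemma transition_apply:
  "c \<in> A \<Longrightarrow> p \<in> fst c \<Longrightarrow> transition c c' (snd c p) = snd c' p"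
  by (simp add: transition_def chart_inv_left)

definition jac :: "('p, 'e) chart \<Rightarrow> ('p, 'e) chart \<Rightarrow> 'p \<Rightarrow> 'e \<Rightarrow> 'e" where
  "jac c c' p = frechet_derivative (transition c c') (at (snd c p))"

lemma has_derivative_transition:
  assumes "c \<in> A" "c' \<in> A" "p \<in> fst c" "p \<in> fst c'"
  shows "(transition c c' has_derivative jac c c' p) (at (snd c p))"
  unfolding jac_def frechet_derivative_works[symmetric]
  using assms by (intro smooth_on_differentiable[OF transition_smooth]) auto

lemma linear_jac:
  "c \<in> A \<Longrightarrow> c' \<in> A \<Longrightarrow> p \<in> fst c \<Longrightarrow> p \<in> fst c' \<Longrightarrow> linear (jac c c' p)"
  using has_derivative_transition has_derivative_linear by blast

text \<open>The chain rule on the open overlap of \<open>c\<close> and \<open>c'\<close>. This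
  cocycle identity is what makes the family \<open>tangent_of\<close> a tangent vector.\<close>

lemma jac_compose:
  assumes A: "c \<in> A" "c' \<in> A" "c'' \<in> A" and p: "p \<in> fst c" "p \<in> fst c'" "p \<in> fst c''"
  shows "jac c' c'' p (jac c c' p x) = jac c c'' p x"
proof -
  have "(transition c' c'' has_derivative jac c' c'' p) (at (transition c c' (snd c p)))"
    using has_derivative_transition[OF A(2,3) p(2,3)] by (simp add: transition_apply A p)
  from has_derivative_compose[OF has_derivative_transition[OF A(1,2) p(1,2)] this]
  have 1: "((\<lambda>x. transition c' c'' (transition c c' x)) has_derivative
      (\<lambda>x. jac c' c'' p (jac c c' p x))) (at (snd c p))" .
  have "(transition c c'' has_derivative (\<lambda>x. jac c' c'' p (jac c c' p x))) (at (snd c p))"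
    by (rule has_derivative_transform_within_open[OF 1 overlap_open[OF A(1,2)]])
      (auto simp: transition_apply A p)
  from fun_cong[OF has_derivative_unique[OF this has_derivative_transition[OF A(1,3) p(1,3)]], of x]
  show ?thesis .
qed

lemma jac_refl:
  assumes "c \<in> A" "p \<in> fst c"
  shows "jac c c p x = x"
proof -
  have "(transition c c has_derivative (\<lambda>x. x)) (at (snd c p))"
    by (rule has_derivative_transform_within_open[OF has_derivative_ident chart_open(2)[OF assms(1)]])
      (use assms in \<open>auto simp: transition_apply\<close>)
  from fun_cong[OF has_derivative_unique[OF has_derivative_transition this], of x]
  show ?thesis using assms by simp
qed

lemma tangent_of_apply:
  "tangent_of A c p x c' = (if c' \<in> A \<and> p \<in> fst c' then jac c c' p x else 0)"
  by (simp add: tangent_of_def jac_def)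

lemma tangent_space_iff:
  "v \<in> tangent_space A p \<longleftrightarrow>
    (\<forall>c\<in>A. \<forall>c'\<in>A. p \<in> fst c \<inter> fst c' \<longrightarrow> v c' = jac c c' p (v c)) \<and>
    (\<forall>c. c \<notin> A \<or> p \<notin> fst c \<longrightarrow> v c = 0)"
  by (simp add: tangent_space_def jac_def)

lemma tangent_of_same: "c \<in> A \<Longrightarrow> p \<in> fst c \<Longrightarrow> tangent_of A c p x c = x"
  by (simp add: tangent_of_apply jac_refl)

lemma tangent_of_in_tangent_space:
  "c \<in> A \<Longrightarrow> p \<in> fst c \<Longrightarrow> tangent_of A c p x \<in> tangent_space A p"
  by (auto simp: tangent_space_iff tangent_of_apply jac_compose)

text \<open>With \<open>tangent_of_same\<close> this identifies the tangent space with the model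
  space in any chart around \<open>p\<close>; the convention of zero components in irrelevant charts
  makes the equality literal.\<close>

lemma tangent_of_component:
  assumes "c \<in> A" "p \<in> fst c" "v \<in> tangent_space A p"
  shows "tangent_of A c p (v c) = v"
proof
  fix c'
  show "tangent_of A c p (v c) c' = v c'"
  proof (cases "c' \<in> A \<and> p \<in> fst c'")
    case True
    then have "v c' = jac c c' p (v c)"
      using assms unfolding tangent_space_iff by blast
    with True show ?thesis by (simp add: tangent_of_apply)
  next
    case False
    then have "v c' = 0"
      using assms unfolding tangent_space_iff by blast
    with False show ?thesis by (auto simp: tangent_of_apply)
  qed
qed

lemma tangent_eqI:
  assumes "c \<in> A" "p \<in> fst c" "v \<in> tangent_space A p" "v' \<in> tangent_space A p" "v c = v' c"
  shows "v = v'"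
  by (rule tangent_of_component[OF assms(1,2,3), unfolded assms(5), symmetric, THEN trans])
    (rule tangent_of_component[OF assms(1,2,4)])

lemma lincomb_in_tangent_space:
  assumes "v \<in> tangent_space A p" "w \<in> tangent_space A p"
  shows "lincomb a v b w \<in> tangent_space A p"
proof -
  have 1: "a *\<^sub>R v c' + b *\<^sub>R w c' = jac c c' p (a *\<^sub>R v c + b *\<^sub>R w c)"
    if "c \<in> A" "c' \<in> A" "p \<in> fst c" "p \<in> fst c'" for c c'
  proof -
    have "v c' = jac c c' p (v c)" "w c' = jac c c' p (w c)"
      using assms that unfolding tangent_space_iff by blast+
    then show ?thesis
      using linear_jac[OF that] by (simp add: linear_add linear_cmul)
  qed
  have 2: "v c = 0" "w c = 0" if "c \<notin> A \<or> p \<notin> fst c" for c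
    using assms that unfolding tangent_space_iff by blast+
  show ?thesis
    unfolding tangent_space_iff lincomb_def
  proof (intro conjI ballI allI impI)
    fix c c' assume "c \<in> A" "c' \<in> A" "p \<in> fst c \<inter> fst c'"
    then show "a *\<^sub>R v c' + b *\<^sub>R w c' = jac c c' p (a *\<^sub>R v c + b *\<^sub>R w c)"
      by (intro 1) blast+
  next
    fix c assume "c \<notin> A \<or> p \<notin> fst c"
    then show "a *\<^sub>R v c + b *\<^sub>R w c = 0" by (simp only: 2) simp
  qed
qed

lemma tangent_of_lincomb:
  assumes "c \<in> A" "p \<in> fst c"
  shows "tangent_of A c p (a *\<^sub>R x + b *\<^sub>R y) = lincomb a (tangent_of A c p x) b (tangent_of A c p y)"
proof (rule tangent_eqI[OF assms])
  show "lincomb a (tangent_of A c p x) b (tangent_of A c p y) \<in> tangent_space A p"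
    by (intro lincomb_in_tangent_space tangent_of_in_tangent_space assms)
qed (simp_all add: assms tangent_of_in_tangent_space tangent_of_same lincomb_def)

end

section \<open>Endomorphisms of tangent spaces and their traces\<close>

definition tangent_endo ::
  "('p, 'e::real_normed_vector) chart set \<Rightarrow> 'p \<Rightarrow> (('p, 'e) tangent \<Rightarrow> ('p, 'e) tangent) \<Rightarrow> bool" where
  "tangent_endo A p L \<longleftrightarrow> (\<forall>X\<in>tangent_space A p. L X \<in> tangent_space A p) \<and>
     (\<forall>X\<in>tangent_space A p. \<forall>Y\<in>tangent_space A p. \<forall>a b.
        L (lincomb a X b Y) = lincomb a (L X) b (L Y))"

lemma tangent_endo_funpow: "tangent_endo A p L \<Longrightarrow> tangent_endo A p (L ^^ j)"
  by (induction j) (auto simp: tangent_endo_def)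

lemma trace_matrix_conjugate:
  fixes P Q :: "real^'n^'n"
  assumes "P ** Q = mat 1"
  shows "trace (Q ** B ** P) = trace B"
  by (metis assms matrix_mul_assoc matrix_mul_lid trace_mul_sym)

locale coordinate_manifold = manifold M A for M :: "'p topology" and A :: "('p, real^'n) chart set"
begin

lemma linear_endo_component:
  assumes "c \<in> A" "p \<in> fst c" "tangent_endo A p L"
  shows "linear (\<lambda>x. L (tangent_of A c p x) c)"
proof -
  have L: "L (tangent_of A c p (a *\<^sub>R x + b *\<^sub>R y)) c =
      a *\<^sub>R L (tangent_of A c p x) c + b *\<^sub>R L (tangent_of A c p y) c" for a b x y
    using assms(3) tangent_of_in_tangent_space[OF assms(1,2)]
    unfolding tangent_of_lincomb[OF assms(1,2)] tangent_endo_def by (simp add: lincomb_def)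
  show ?thesis
    by (rule linearI) (use L[of 1 _ 1] L[of _ _ 0] in simp_all)
qed

lemma endo_matrix_eq: "endo_matrix A c p L = matrix (\<lambda>x. L (tangent_of A c p x) c)"
  by (simp add: endo_matrix_def matrix_def)

lemma endo_matrix_works:
  assumes "c \<in> A" "p \<in> fst c" "tangent_endo A p L" "X \<in> tangent_space A p"
  shows "L X c = endo_matrix A c p L *v X c"
  unfolding endo_matrix_eq
  using fun_cong[OF matrix_vector_mul(2)[OF linear_endo_component[OF assms(1-3)]], of "X c"]
    tangent_of_component[OF assms(1,2,4)] by simp

lemma endo_matrix_compose:
  assumes c: "c \<in> A" "p \<in> fst c" and L: "tangent_endo A p L" "tangent_endo A p L'"
  shows "endo_matrix A c p (L \<circ> L') = endo_matrix A c p L ** endo_matrix A c p L'"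
proof -
  have "(\<lambda>x. (L \<circ> L') (tangent_of A c p x) c) =
      (\<lambda>x. L (tangent_of A c p x) c) \<circ> (\<lambda>x. L' (tangent_of A c p x) c)"
  proof
    fix x
    have "L' (tangent_of A c p x) \<in> tangent_space A p"
      using L(2) tangent_of_in_tangent_space[OF c] by (simp add: tangent_endo_def)
    then show "(L \<circ> L') (tangent_of A c p x) c =
        ((\<lambda>x. L (tangent_of A c p x) c) \<circ> (\<lambda>x. L' (tangent_of A c p x) c)) x"
      by (simp add: tangent_of_component[OF c])
  qed
  then show ?thesis
    unfolding endo_matrix_eq
    using matrix_compose[OF linear_endo_component[OF c L(2)] linear_endo_component[OF c L(1)]] by simp
qed

lemma endo_matrix_funpow:
  assumes "c \<in> A" "p \<in> fst c" "tangent_endo A p L"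
  shows "endo_matrix A c p (L ^^ j) = mpow (endo_matrix A c p L) j"
proof (induction j)
  case 0
  then show ?case
    by (simp add: endo_matrix_def tangent_of_same assms mat_def vec_eq_iff axis_def)
next
  case (Suc j)
  then show ?case
    by (simp only: mpow_Suc funpow.simps(2) tangent_endo_funpow endo_matrix_compose assms)
qed

text \<open>The Jacobians of the two transition maps are inverse to each other, so the matrices are
  conjugate. This frees \<open>fibre_trace\<close> from the chart chosen by
  \<open>chart_at\<close>.\<close>

lemma trace_endo_matrix_cong:
  assumes A: "c \<in> A" "c' \<in> A" and p: "p \<in> fst c" "p \<in> fst c'" and L: "tangent_endo A p L"
  shows "trace (endo_matrix A c' p L) = trace (endo_matrix A c p L)"
proof -
  let ?f = "\<lambda>c x. L (tangent_of A c p x) c"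
  have id: "jac c' c p \<circ> jac c c' p = id" "jac c c' p \<circ> jac c' c p = id"
    using A p by (auto simp: fun_eq_iff jac_compose jac_refl)
  have "?f c' = jac c c' p \<circ> ?f c \<circ> jac c' c p"
  proof
    fix x
    have "tangent_of A c p (jac c' c p x) = tangent_of A c' p x"
      using tangent_of_component[OF A(1) p(1) tangent_of_in_tangent_space[OF A(2) p(2)], of x] A p
      by (simp add: tangent_of_apply)
    moreover have "L (tangent_of A c' p x) \<in> tangent_space A p"
      using L tangent_of_in_tangent_space[OF A(2) p(2)] by (simp add: tangent_endo_def)
    then have "L (tangent_of A c' p x) c' = jac c c' p (L (tangent_of A c' p x) c)"
      using A p unfolding tangent_space_iff by blast
    ultimately show "?f c' x = (jac c c' p \<circ> ?f c \<circ> jac c' c p) x" by simp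
  qed
  moreover note lin = linear_jac[OF A p] linear_jac[OF A(2,1) p(2,1)]
    linear_endo_component[OF A(1) p(1) L]
  ultimately have "matrix (?f c') = matrix (jac c c' p) ** matrix (?f c) ** matrix (jac c' c p)"
    by (simp add: matrix_compose linear_compose matrix_mul_assoc)
  moreover have "matrix (jac c' c p) ** matrix (jac c c' p) = mat 1"
    using matrix_compose[OF lin(1,2)] id(1) by (simp add: matrix_id_mat_1)
  ultimately show ?thesis
    unfolding endo_matrix_eq by (simp add: trace_matrix_conjugate)
qed

lemma chart_at:
  assumes "p \<in> fst c" "c \<in> A"
  shows "chart_at A p \<in> A" "p \<in> fst (chart_at A p)"
  using someI[of "\<lambda>c. c \<in> A \<and> p \<in> fst c" c] assms unfolding chart_at_def by blast+

lemma fibre_trace_eq: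
  "c \<in> A \<Longrightarrow> p \<in> fst c \<Longrightarrow> tangent_endo A p L \<Longrightarrow> fibre_trace A p L = trace (endo_matrix A c p L)"
  unfolding fibre_trace_def by (rule trace_endo_matrix_cong) (auto intro: chart_at)

section \<open>Natural charts of the slit tangent bundle\<close>

abbreviation lifted :: "('p, real^'n) chart \<Rightarrow> (('p, 'n) tvec, (real^'n) \<times> (real^'n)) chart" where
  "lifted \<equiv> lift_chart A"

text \<open>The image of the natural chart, by \<open>lifted_image\<close>; as a product it is
  visibly open and stable under positive scaling of u.\<close>

definition coord_dom :: "('p, real^'n) chart \<Rightarrow> ((real^'n) \<times> (real^'n)) set" where
  "coord_dom c = (snd c ` fst c) \<times> (- {0})"

definition loc :: "('p, real^'n) chart \<Rightarrow> (('p, 'n) tvec \<Rightarrow> 'b) \<Rightarrow> (real^'n) \<times> (real^'n) \<Rightarrow> 'b" where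
  "loc c f = f \<circ> chart_inv (lifted c)"

lemma open_dom: "c \<in> A \<Longrightarrow> open (coord_dom c)"
  unfolding coord_dom_def by (intro open_Times chart_open) auto

lemma mem_lifted:
  "c \<in> A \<Longrightarrow> (p, v) \<in> fst (lifted c) \<longleftrightarrow> p \<in> fst c \<and> v \<in> tangent_space A p \<and> v \<noteq> (\<lambda>c. 0)"
  unfolding lift_chart_def slit_bundle_def tangent_bundle_def by auto

lemma zero_in_tangent_space: "p \<in> fst c \<Longrightarrow> c \<in> A \<Longrightarrow> (\<lambda>c. 0) \<in> tangent_space A p"
  unfolding tangent_space_iff by (auto simp: linear_0[OF linear_jac])

lemma lifted_apply: "snd (lifted c) (p, v) = (snd c p, v c)"
  by (simp add: lift_chart_def)

lemma lifted_inj: "c \<in> A \<Longrightarrow> inj_on (snd (lifted c)) (fst (lifted c))"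
proof (rule inj_onI)
  fix w w' assume c: "c \<in> A" and w: "w \<in> fst (lifted c)" "w' \<in> fst (lifted c)"
    "snd (lifted c) w = snd (lifted c) w'"
  obtain p v p' v' where [simp]: "w = (p, v)" "w' = (p', v')" by fastforce
  have m: "p \<in> fst c" "p' \<in> fst c" "v \<in> tangent_space A p" "v' \<in> tangent_space A p'"
    using w(1,2) mem_lifted[OF c] by auto
  have eq: "snd c p = snd c p'" "v c = v' c" using w(3) by (auto simp: lifted_apply)
  have "p = p'" using inj_onD[OF chart_inj[OF c] eq(1)] m by simp
  moreover have "v = v'" using tangent_eqI[OF c m(1,3)] m(4) eq(2) \<open>p = p'\<close> by simp
  ultimately show "w = w'" by simp
qed

lemma lifted_inv_left: "c \<in> A \<Longrightarrow> w \<in> fst (lifted c) \<Longrightarrow> chart_inv (lifted c) (snd (lifted c) w) = w"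
  unfolding chart_inv_def by (rule inv_into_f_f[OF lifted_inj])

lemma lifted_in_dom: "c \<in> A \<Longrightarrow> w \<in> fst (lifted c) \<Longrightarrow> snd (lifted c) w \<in> coord_dom c"
proof -
  assume c: "c \<in> A" and w: "w \<in> fst (lifted c)"
  obtain p v where [simp]: "w = (p, v)" by fastforce
  have m: "p \<in> fst c" "v \<in> tangent_space A p" "v \<noteq> (\<lambda>c. 0)"
    using w mem_lifted[OF c] by auto
  have "v c \<noteq> 0"
    using tangent_eqI[OF c m(1,2) zero_in_tangent_space[OF m(1) c]] m(3) by auto
  then show ?thesis using m by (simp add: coord_dom_def lifted_apply)
qed

lemma tangent_of_in_lifted:
  "c \<in> A \<Longrightarrow> p \<in> fst c \<Longrightarrow> x \<noteq> 0 \<Longrightarrow> (p, tangent_of A c p x) \<in> fst (lifted c)"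
  using mem_lifted tangent_of_in_tangent_space tangent_of_same by metis

lemma lifted_inv_apply:
  "c \<in> A \<Longrightarrow> p \<in> fst c \<Longrightarrow> x \<noteq> 0 \<Longrightarrow> chart_inv (lifted c) (snd c p, x) = (p, tangent_of A c p x)"
  using lifted_inv_left[OF _ tangent_of_in_lifted] by (simp add: lifted_apply tangent_of_same)

lemma dom_cases:
  assumes "c \<in> A" "z \<in> coord_dom c"
  obtains w where "w \<in> fst (lifted c)" "snd (lifted c) w = z" "chart_inv (lifted c) z = w"
proof -
  obtain p x where z: "z = (snd c p, x)" "p \<in> fst c" "x \<noteq> 0"
    using assms(2) unfolding coord_dom_def by auto
  show thesis
    by (rule that[OF tangent_of_in_lifted[OF assms(1) z(2,3)]])
      (simp_all add: lifted_apply z tangent_of_same assms lifted_inv_apply)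
qed

lemma lifted_image: "c \<in> A \<Longrightarrow> snd (lifted c) ` fst (lifted c) = coord_dom c"
proof
  assume c: "c \<in> A"
  show "snd (lifted c) ` fst (lifted c) \<subseteq> coord_dom c"
    using lifted_in_dom[OF c] by blast
  show "coord_dom c \<subseteq> snd (lifted c) ` fst (lifted c)"
  proof
    fix z assume "z \<in> coord_dom c"
    then obtain w where "w \<in> fst (lifted c)" "snd (lifted c) w = z"
      using dom_cases[OF c] by metis
    then show "z \<in> snd (lifted c) ` fst (lifted c)" by blast
  qed
qed

lemma smooth_in_lifted: "c \<in> A \<Longrightarrow> smooth_in (lifted c) f \<longleftrightarrow> smooth_on (loc c f) (coord_dom c)"
  unfolding smooth_in_def loc_def by (simp add: lifted_image)

lemma loc_apply: "c \<in> A \<Longrightarrow> w \<in> fst (lifted c) \<Longrightarrow> loc c f (snd (lifted c) w) = f w"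
  by (simp add: loc_def lifted_inv_left)

lemma chart_deriv_lifted: "chart_deriv (lifted c) a f w = dd (loc c f) a (snd (lifted c) w)"
  by (simp add: chart_deriv_def dd_def loc_def)

lemma d_u_eq: "d_u A c i f w = dd (loc c f) (0, axis i 1) (snd (lifted c) w)"
  and d_q_eq: "d_q A c i f w = dd (loc c f) (axis i 1, 0) (snd (lifted c) w)"
  by (simp_all add: d_u_def d_q_def chart_deriv_lifted)

text \<open>Needed for iterated \<open>d_u\<close>: the inner derivative becomes \<open>dd\<close>
  on the whole open set \<open>coord_dom c\<close>, where \<open>dd_cong\<close> can use it.\<close>

lemma loc_d_u:
  assumes "c \<in> A" "z \<in> coord_dom c"
  shows "loc c (d_u A c i f) z = dd (loc c f) (0, axis i 1) z"
proof -
  obtain w where w: "w \<in> fst (lifted c)" "snd (lifted c) w = z"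
    using dom_cases[OF assms] by metis
  show ?thesis
    using loc_apply[OF assms(1) w(1), of "d_u A c i f"] by (simp only: d_u_eq w(2))
qed

text \<open>Along a fibre the natural charts are linear, so both sides are the derivative of \<open>f\<close>
  at \<open>w\<close> in the direction of the tangent vector \<open>X\<close>.\<close>

lemma vertical_derivative_cong:
  fixes f f' :: "('p, 'n) tvec \<Rightarrow> real"
  assumes A: "c \<in> A" "c' \<in> A" and w: "w \<in> slit_bundle A" "fst w \<in> fst c" "fst w \<in> fst c'"
    and X: "X \<in> tangent_space A (fst w)"
    and diff: "loc c f differentiable (at (snd (lifted c) w))"
      "loc c' f' differentiable (at (snd (lifted c') w))"
    and eq: "\<And>v. (fst w, v) \<in> slit_bundle A \<Longrightarrow> f (fst w, v) = f' (fst w, v)"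
  shows "dd (loc c f) (0, X c) (snd (lifted c) w) = dd (loc c' f') (0, X c') (snd (lifted c') w)"
proof -
  obtain p v where [simp]: "w = (p, v)" by fastforce
  have v: "v \<in> tangent_space A p" "v \<noteq> (\<lambda>c. 0)" and p: "p \<in> fst c" "p \<in> fst c'"
    and X: "X \<in> tangent_space A p"
    using w X by (auto simp: slit_bundle_def tangent_bundle_def)
  have line: "((\<lambda>t. f (p, lincomb 1 v t X)) has_real_derivative dd (loc c f) (0, X c) (snd (lifted c) w)) (at 0)"
    and near: "\<exists>S. open S \<and> 0 \<in> S \<and> (\<forall>t\<in>S. (p, lincomb 1 v t X) \<in> slit_bundle A)"
    if c: "c \<in> A" "p \<in> fst c" and d: "loc c f differentiable (at (snd (lifted c) w))" for c f
  proof -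
    have "v c \<noteq> 0"
      using tangent_eqI[OF c v(1) zero_in_tangent_space[OF c(2,1)]] v(2) by auto
    \<comment> \<open>The times at which the line v + t X avoids the zero vector, where the bundle
      has been slit.\<close>
    define S where "S = {t. v c + t *\<^sub>R X c \<noteq> 0}"
    have S: "open S" "0 \<in> S"
      unfolding S_def using \<open>v c \<noteq> 0\<close>
      by (auto intro!: open_Collect_neq continuous_intros)
    have tan: "tangent_of A c p (v c + t *\<^sub>R X c) = lincomb 1 v t X" for t
      using tangent_of_lincomb[OF c, of 1 "v c" t "X c"] by (simp add: tangent_of_component[OF c] v X)
    have inv: "chart_inv (lifted c) (snd c p, v c + t *\<^sub>R X c) = (p, lincomb 1 v t X)" if "t \<in> S" for t
      using lifted_inv_apply[OF c] that tan by (simp add: S_def)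
    have mem: "(p, lincomb 1 v t X) \<in> slit_bundle A" if "t \<in> S" for t
      using tangent_of_in_lifted[OF c] that tan[of t] unfolding S_def lift_chart_def
      by (metis (mono_tags, lifting) fst_conv mem_Collect_eq)
    have "((\<lambda>t. loc c f ((snd c p, v c) + t *\<^sub>R (0, X c))) has_real_derivative
        dd (loc c f) (0, X c) ((snd c p, v c) + 0 *\<^sub>R (0, X c))) (at 0)"
      by (rule dd_along_line) (use d in \<open>simp add: lifted_apply\<close>)
    then have 1: "((\<lambda>t. loc c f (snd c p, v c + t *\<^sub>R X c)) has_real_derivative
        dd (loc c f) (0, X c) (snd (lifted c) w)) (at 0)" by (simp add: lifted_apply)
    show "((\<lambda>t. f (p, lincomb 1 v t X)) has_real_derivative dd (loc c f) (0, X c) (snd (lifted c) w)) (at 0)"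
      by (rule has_field_derivative_transform_within_open[OF 1 S]) (simp add: loc_def inv)
    show "\<exists>S. open S \<and> 0 \<in> S \<and> (\<forall>t\<in>S. (p, lincomb 1 v t X) \<in> slit_bundle A)"
      using S mem by blast
  qed
  obtain S where S: "open S" "0 \<in> S" "\<And>t. t \<in> S \<Longrightarrow> (p, lincomb 1 v t X) \<in> slit_bundle A"
    using near[OF A(1) p(1) diff(1)] by auto
  have "((\<lambda>t. f' (p, lincomb 1 v t X)) has_real_derivative dd (loc c f) (0, X c) (snd (lifted c) w)) (at 0)"
    by (rule has_field_derivative_transform_within_open[OF line[OF A(1) p(1) diff(1)] S(1,2)])
      (use eq S(3) in simp)
  then show ?thesis
    using DERIV_unique line[OF A(2) p(2) diff(2)] by blast
qed

end


section \<open>The metric and the spray of a Finsler space\<close>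

lemma linear_real_expand:
  fixes f :: "real^'n \<Rightarrow> real"
  assumes "linear f"
  shows "f x = (\<Sum>i\<in>UNIV. f (axis i 1) * x $ i)"
proof -
  have "f (\<Sum>i\<in>UNIV. x $ i *\<^sub>R axis i 1) = (\<Sum>i\<in>UNIV. f (axis i 1) * x $ i)"
    by (simp add: linear_sum[OF assms] linear_cmul[OF assms] mult.commute)
  then show ?thesis
    using basis_expansion[of x] by (simp add: scalar_mult_eq_scaleR)
qed

lemma linear_Pair_slots:
  assumes "linear f"
  shows "linear (\<lambda>y. f (0, y))" "linear (\<lambda>y. f (y, 0))"
proof -
  have "linear (Pair 0)" "linear (\<lambda>y. (y, 0))"
    by (simp_all add: linearI)
  from this[THEN linear_compose, OF assms]
  show "linear (\<lambda>y. f (0, y))" "linear (\<lambda>y. f (y, 0))"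
    by (simp_all add: o_def)
qed

lemma bilinear_matrix:
  fixes f :: "real^'n \<Rightarrow> real^'n \<Rightarrow> real"
  assumes "bilinear f"
  shows "f a b = a \<bullet> ((\<chi> i j. f (axis i 1) (axis j 1)) *v b)"
proof -
  have "linear (\<lambda>a. f a b)" "linear (f a)" for a b
    using assms by (simp_all add: bilinear_def)
  then have "f a b = (\<Sum>i\<in>UNIV. (\<Sum>j\<in>UNIV. f (axis i 1) (axis j 1) * b $ j) * a $ i)"
    using linear_real_expand[of "\<lambda>a. f a b" a] linear_real_expand[of "f (axis _ 1)" b] by simp
  then show ?thesis
    by (simp add: inner_vec_def matrix_vector_mult_def mult.commute)
qed

lemma matrix_entry: "(B :: real^'n^'n) $ i $ j = axis i 1 \<bullet> (B *v axis j 1)"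
  by (simp add: inner_axis' matrix_vector_mul_component inner_axis row_def)

lemma matrix_eqI:
  fixes B C :: "real^'n^'n"
  assumes "\<And>i j. axis i 1 \<bullet> (B *v axis j 1) = axis i 1 \<bullet> (C *v axis j 1)"
  shows "B = C"
  unfolding vec_eq_iff using assms by (simp only: matrix_entry) simp

lemma differentiable_matrix:
  fixes f :: "'m::real_normed_vector \<Rightarrow> real^'n^'n"
  assumes "\<And>i j. (\<lambda>y. f y $ i $ j) differentiable (at x)"
  shows "f differentiable (at x)"
proof -
  have "(\<lambda>y. f y \<bullet> b) differentiable (at x)" if b: "b \<in> Basis" for b
  proof -
    obtain i j where "b = axis i (axis j 1)"
      using b by (auto simp: Basis_vec_def)
    then show ?thesis
      using assms[of i j] by (simp add: inner_axis)
  qed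
  then show ?thesis
    using differentiable_componentwise_within[of f x UNIV] by blast
qed

lemma dd_matrix_entry:
  fixes f :: "'m::real_normed_vector \<Rightarrow> real^'n^'n"
  assumes "f differentiable (at x)"
  shows "dd f v x $ i $ j = dd (\<lambda>y. f y $ i $ j) v x"
  using dd_bounded_linear[OF bounded_linear_compose[OF bounded_linear_vec_nth[of j]
        bounded_linear_vec_nth[of i]] assms, of v] by simp

lemma differentiable_cong_open:
  assumes "open U" "x \<in> U" "\<And>y. y \<in> U \<Longrightarrow> f y = g y" "f differentiable (at x)"
  shows "g differentiable (at x)"
  using has_derivative_transform_within_open[OF has_derivative_dd[OF assms(4)] assms(1-3)]
  by (auto intro: differentiableI)

locale finsler_manifold = coordinate_manifold M A
  for M :: "'p topology" and A :: "('p, real^'n) chart set" +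
  fixes E :: "('p, 'n) tvec \<Rightarrow> real"
  assumes finsler: "finsler_space A E"
begin

lemma in_lifted: "w \<in> slit_bundle A \<Longrightarrow> fst w \<in> fst c \<Longrightarrow> w \<in> fst (lifted c)"
  and lifted_in_slit: "w \<in> fst (lifted c) \<Longrightarrow> w \<in> slit_bundle A \<and> fst w \<in> fst c"
  by (simp_all add: lift_chart_def)

lemma velocity_in_tangent_space: "w \<in> slit_bundle A \<Longrightarrow> snd w \<in> tangent_space A (fst w)"
  by (auto simp: slit_bundle_def tangent_bundle_def)

lemma energy_square:
  "\<exists>F. finsler_function A F \<and> (\<forall>w\<in>tangent_bundle A. E w = (F w)\<^sup>2)"
  using finsler unfolding finsler_space_def by blast

lemma energy_smooth:
  assumes c: "c \<in> A"
  shows "smooth_on (loc c E) (coord_dom c)"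
proof -
  obtain F where F: "finsler_function A F" "\<And>w. w \<in> tangent_bundle A \<Longrightarrow> E w = (F w)\<^sup>2"
    using energy_square by blast
  have sF: "smooth_on (loc c F) (coord_dom c)"
    using F(1) c unfolding finsler_function_def slit_atlas_def smooth_in_lifted[OF c, symmetric] by blast
  have eq: "loc c F z * loc c F z = loc c E z" if z: "z \<in> coord_dom c" for z
  proof -
    obtain w where w: "w \<in> fst (lifted c)" "chart_inv (lifted c) z = w"
      using dom_cases[OF c z] by metis
    then have "w \<in> tangent_bundle A" by (auto simp: lift_chart_def slit_bundle_def)
    then show ?thesis using F(2) w(2) by (simp add: loc_def power2_eq_square)
  qed
  show ?thesis
    by (rule smooth_on_cong[OF open_dom[OF c] eq smooth_on_mult[OF open_dom[OF c] sF sF]])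
qed

lemma energy_homogeneous:
  assumes c: "c \<in> A" and z: "(q, u) \<in> coord_dom c" and r: "r > 0"
  shows "loc c E (q, r *\<^sub>R u) = r\<^sup>2 * loc c E (q, u)"
proof -
  obtain F where F: "finsler_function A F" "\<And>w. w \<in> tangent_bundle A \<Longrightarrow> E w = (F w)\<^sup>2"
    using energy_square by blast
  obtain p where p: "p \<in> fst c" "q = snd c p" and u: "u \<noteq> 0"
    using z by (auto simp: coord_dom_def)
  define v where "v = tangent_of A c p u"
  have v: "v \<in> tangent_space A p" unfolding v_def by (rule tangent_of_in_tangent_space[OF c p(1)])
  have sc: "tangent_of A c p (r *\<^sub>R u) = (\<lambda>c. r *\<^sub>R v c)"
    using tangent_of_lincomb[OF c p(1), of r u 0 u] by (simp add: v_def lincomb_def)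
  have mem: "(p, v) \<in> tangent_bundle A" "(p, \<lambda>c. r *\<^sub>R v c) \<in> tangent_bundle A"
    using v tangent_of_in_tangent_space[OF c p(1), of "r *\<^sub>R u"] p(1) c
    by (auto simp: tangent_bundle_def sc)
  have "F (p, \<lambda>c. r *\<^sub>R v c) = r * F (p, v)"
    using F(1) mem(1) r unfolding finsler_function_def by fast
  then have "E (p, \<lambda>c. r *\<^sub>R v c) = r\<^sup>2 * E (p, v)"
    by (simp add: F(2) mem power_mult_distrib)
  then show ?thesis
    using lifted_inv_apply[OF c p(1) u] lifted_inv_apply[OF c p(1), of "r *\<^sub>R u"] r u
    by (simp add: loc_def p(2) sc v_def)
qed

lemma energy_differentiable:
  assumes "c \<in> A" "z \<in> coord_dom c"
  shows "loc c E differentiable (at z)" "dd (loc c E) a differentiable (at z)"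
  using smooth_on_differentiable[OF _ assms(2)] energy_smooth[OF assms(1)] smooth_on_dd by blast+

lemma linear_vertical: "f differentiable (at z) \<Longrightarrow> linear (\<lambda>v. dd f (0, v) z)"
  by (rule linear_Pair_slots(1)[OF linear_dd])

text \<open>The value is the derivative of E along the fibre in direction \<open>Y\<close>, so the
  chart chosen by \<open>chart_at\<close> may be replaced by any other.\<close>

lemma theta_eq:
  assumes c: "c \<in> A" and w: "w \<in> slit_bundle A" "fst w \<in> fst c" and Y: "Y \<in> tangent_space A (fst w)"
  shows "theta A E w Y = dd (loc c E) (0, Y c) (snd (lifted c) w)"
proof -
  let ?c = "chart_at A (fst w)"
  have c': "?c \<in> A" "fst w \<in> fst ?c" using chart_at[OF w(2) c] by auto
  note d = energy_differentiable(1)[OF _ lifted_in_dom[OF _ in_lifted[OF w(1)]]]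
  have "theta A E w Y = dd (loc ?c E) (0, Y ?c) (snd (lifted ?c) w)"
    using linear_real_expand[OF linear_vertical[OF d[OF c'(1,1,2)]], of "Y ?c"]
    by (simp add: theta_def Let_def d_u_eq)
  also have "\<dots> = dd (loc c E) (0, Y c) (snd (lifted c) w)"
    by (rule vertical_derivative_cong[OF c'(1) c w(1) c'(2) w(2) Y d[OF c'(1,1,2)] d[OF c c w(2)] refl])
  finally show ?thesis .
qed

lemma finsler_metric_eq:
  assumes c: "c \<in> A" and w: "w \<in> slit_bundle A" "fst w \<in> fst c"
    and XY: "X \<in> tangent_space A (fst w)" "Y \<in> tangent_space A (fst w)"
  shows "finsler_metric A E w X Y = dd (dd (loc c E) (0, Y c)) (0, X c) (snd (lifted c) w)"
proof -
  let ?c = "chart_at A (fst w)" and ?H = "\<lambda>c X Y. dd (dd (loc c E) (0, Y)) (0, X) (snd (lifted c) w)"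
  have c': "?c \<in> A" "fst w \<in> fst ?c" using chart_at[OF w(2) c] by auto
  \<comment> \<open>The components of \<open>Y\<close> in \<open>c\<close> are frozen here over all
    of \<open>coord_dom c\<close>. The functions for two charts need agree only on the fibre over
    \<open>fst w\<close>, which is why \<open>vertical_derivative_cong\<close> compares two
    functions along one fibre.\<close>
  define \<theta> where "\<theta> c w' = dd (loc c E) (0, Y c) (snd (lifted c) w')" for c and w' :: "('p, 'n) tvec"
  have loc_\<theta>: "loc c (\<theta> c) z = dd (loc c E) (0, Y c) z" if "c \<in> A" "z \<in> coord_dom c" for c z
  proof -
    note cz = that
    obtain w' where w': "w' \<in> fst (lifted c)" "snd (lifted c) w' = z"
      using dom_cases[OF cz] by metis
    show ?thesis
      using loc_apply[OF cz(1) w'(1), of "\<theta> c"] unfolding w'(2) \<theta>_def .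
  qed
  have z: "snd (lifted c) w \<in> coord_dom c" if "c \<in> A" "fst w \<in> fst c" for c
    using lifted_in_dom[OF that(1) in_lifted[OF w(1) that(2)]] .
  have \<theta>_diff: "loc c (\<theta> c) differentiable (at (snd (lifted c) w))" if "c \<in> A" "fst w \<in> fst c" for c
    by (rule differentiable_cong_open[OF open_dom[OF that(1)] z[OF that] loc_\<theta>[OF that(1), symmetric]
          energy_differentiable(2)[OF that(1) z[OF that]]])
  have dd_\<theta>: "dd (loc c (\<theta> c)) a (snd (lifted c) w) = dd (dd (loc c E) (0, Y c)) a (snd (lifted c) w)"
    if "c \<in> A" "fst w \<in> fst c" for c a
    by (rule dd_cong[OF open_dom[OF that(1)] z[OF that] loc_\<theta>[OF that(1)]])
  let ?z = "snd (lifted ?c) w"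
  have "d_u A ?c i (d_u A ?c j E) w = ?H ?c (axis i 1) (axis j 1)" for i j
    unfolding d_u_eq[of _ i] by (rule dd_cong[OF open_dom[OF c'(1)] z[OF c']]) (rule loc_d_u[OF c'(1)])
  then have 1: "finsler_metric A E w X Y =
      (\<Sum>i\<in>UNIV. (\<Sum>j\<in>UNIV. ?H ?c (axis i 1) (axis j 1) * Y ?c $ j) * X ?c $ i)"
    by (simp add: finsler_metric_def Let_def sum_distrib_left sum_distrib_right mult_ac)
  have 2: "(\<Sum>j\<in>UNIV. ?H ?c x (axis j 1) * Y ?c $ j) = ?H ?c x (Y ?c)" for x
  proof -
    have "linear (\<lambda>y. ?H ?c x y)"
      by (rule linear_Pair_slots(1)[OF linear_dd_field_direction[OF energy_smooth[OF c'(1)]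
            open_dom[OF c'(1)] z[OF c']]])
    from linear_real_expand[OF this, symmetric] show ?thesis .
  qed
  have "(\<Sum>i\<in>UNIV. ?H ?c (axis i 1) (Y ?c) * X ?c $ i) = ?H ?c (X ?c) (Y ?c)"
    by (rule linear_real_expand[OF linear_vertical[OF energy_differentiable(2)[OF c'(1) z[OF c']]], symmetric])
  then have "finsler_metric A E w X Y = ?H ?c (X ?c) (Y ?c)"
    unfolding 1 2 .
  also have "\<dots> = dd (loc ?c (\<theta> ?c)) (0, X ?c) ?z"
    by (rule dd_\<theta>[OF c', symmetric])
  also have "\<dots> = dd (loc c (\<theta> c)) (0, X c) (snd (lifted c) w)"
  proof (rule vertical_derivative_cong[OF c'(1) c w(1) c'(2) w(2) XY(1) \<theta>_diff[OF c'] \<theta>_diff[OF c w(2)]])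
    fix v assume v: "(fst w, v) \<in> slit_bundle A"
    \<comment> \<open>Chart independence is used twice: here for the first fibre derivative of E,
      and outside for the derivative of the result.\<close>
    show "\<theta> ?c (fst w, v) = \<theta> c (fst w, v)"
      unfolding \<theta>_def using c' c w XY(2)
      by (intro vertical_derivative_cong v energy_differentiable(1) lifted_in_dom in_lifted) auto
  qed
  also have "\<dots> = ?H c (X c) (Y c)"
    by (rule dd_\<theta>[OF c w(2)])
  finally show ?thesis .
qed

lemma cartan_form1_loc:
  assumes "c \<in> A" "z \<in> coord_dom c"
  shows "loc c (cartan_form1 A c E \<xi>) z = dd (loc c E) (0, fst \<xi>) z"
proof -
  obtain w where w: "w \<in> fst (lifted c)" "snd (lifted c) w = z"
    using dom_cases[OF assms] by metis
  have "loc c (cartan_form1 A c E \<xi>) z = cartan_form1 A c E \<xi> w"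
    using loc_apply[OF assms(1) w(1), of "cartan_form1 A c E \<xi>"] w(2) by simp
  then show ?thesis
    using linear_real_expand[OF linear_vertical[OF energy_differentiable(1)[OF assms]], of "fst \<xi>"]
    by (simp add: cartan_form1_def d_u_eq w(2))
qed

text \<open>The Cartan 1-form vanishes on vertical vectors. So the Cartan 2-form of (0, \<xi>) with
  any vector is just the Hessian of \<xi> with the q-part of that vector, and a null vector \<xi> of
  the Hessian gives a null vector (0, \<xi>) of the 2-form.\<close>

lemma metric_nondegenerate:
  assumes c: "c \<in> A" and z: "z \<in> coord_dom c"
    and null: "\<And>\<eta>. dd (dd (loc c E) (0, \<xi>)) (0, \<eta>) z = 0"
  shows "\<xi> = 0"
proof -
  obtain w where w: "w \<in> fst (lifted c)" "snd (lifted c) w = z"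
    using dom_cases[OF c z] by metis
  have "chart_deriv (lifted c) a (cartan_form1 A c E \<eta>) w = dd (dd (loc c E) (0, fst \<eta>)) a z" for a \<eta>
    unfolding chart_deriv_lifted w(2)
    by (rule dd_cong[OF open_dom[OF c] z]) (rule cartan_form1_loc[OF c])
  moreover have "dd (dd (loc c E) (0, fst \<eta>)) (0, \<xi>) z = 0" for \<eta> :: "(real^'n) \<times> (real^'n)"
    using null dd_commute[OF energy_smooth[OF c] open_dom[OF c] z] by metis
  moreover have "dd (dd (loc c E) (0, 0)) \<eta> z = 0" for \<eta>
  proof -
    have "dd (dd (loc c E) (0, 0)) \<eta> z = dd (\<lambda>y. 0) \<eta> z"
      by (rule dd_cong[OF open_dom[OF c] z])
        (use linear_0[OF linear_dd[OF energy_differentiable(1)[OF c]]] in \<open>simp add: zero_prod_def\<close>)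
    then show ?thesis by simp
  qed
  ultimately have "cartan_form2 A c E (0, \<xi>) \<eta> w = 0" for \<eta>
    by (simp add: cartan_form2_def)
  then have "(0, \<xi>) = (0 :: (real^'n) \<times> (real^'n))"
    using finsler c w(1) unfolding finsler_space_def by blast
  then show ?thesis by (simp add: zero_prod_def)
qed

end

locale finsler_spray = finsler_manifold M A E
  for M :: "'p topology" and A :: "('p, real^'n) chart set" and E :: "('p, 'n) tvec \<Rightarrow> real" +
  fixes \<Gamma> :: "('p, 'n) tvec \<Rightarrow> (('p, 'n) tvec, (real^'n) \<times> (real^'n)) tangent"
  assumes geodesic_spray: "geodesic_spray A E \<Gamma>"
begin

definition force :: "('p, real^'n) chart \<Rightarrow> (real^'n) \<times> (real^'n) \<Rightarrow> real^'n" where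
  "force c = loc c (\<lambda>w. snd (\<Gamma> w (lifted c)))"

lemma spray_components:
  assumes "c \<in> A" "w \<in> fst (lifted c)"
  shows "\<Gamma> w (lifted c) = (snd (snd (lifted c) w), force c (snd (lifted c) w))"
proof -
  have "fst (\<Gamma> w (lifted c)) = snd w c"
    using geodesic_spray assms unfolding geodesic_spray_def by blast
  moreover have "snd (snd (lifted c) w) = snd w c"
    using lifted_apply[of c "fst w" "snd w"] by simp
  ultimately show ?thesis
    using loc_apply[OF assms, of "\<lambda>w. snd (\<Gamma> w (lifted c))"] by (simp add: force_def prod_eq_iff)
qed

lemma local_spray:
  assumes c: "c \<in> A"
  shows "local_spray (coord_dom c) (loc c E) (force c)"
proof
  show "open (coord_dom c)" by (rule open_dom[OF c])
  show "smooth_on (loc c E) (coord_dom c)" by (rule energy_smooth[OF c])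
  show "force c differentiable (at z)" if z: "z \<in> coord_dom c" for z
  proof -
    have sm: "smooth_on (loc c (\<lambda>w. \<Gamma> w (lifted c))) (coord_dom c)"
      using geodesic_spray c
      unfolding geodesic_spray_def vector_field_def slit_atlas_def smooth_in_lifted[OF c, symmetric]
      by blast
    have "(\<lambda>z. snd (loc c (\<lambda>w. \<Gamma> w (lifted c)) z)) differentiable (at z)"
      by (rule differentiable_bounded_linear[OF bounded_linear_snd smooth_on_differentiable[OF sm z]])
    then show ?thesis by (simp add: force_def loc_def o_def)
  qed
  show "(q, r *\<^sub>R u) \<in> coord_dom c" if "(q, u) \<in> coord_dom c" "r > 0" for q u r
    using that by (simp add: coord_dom_def)
  show "loc c E (q, r *\<^sub>R u) = r\<^sup>2 * loc c E (q, u)" if "(q, u) \<in> coord_dom c" "r > 0" for q u r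
    by (rule energy_homogeneous[OF c that])
  show "\<xi> = 0" if "z \<in> coord_dom c" "\<And>\<eta>. dd (dd (loc c E) (0, \<xi>)) (0, \<eta>) z = 0" for z \<xi>
    by (rule metric_nondegenerate[OF c that])
  show "dd (dd (loc c E) (0, \<eta>)) (snd z, force c z) z = dd (loc c E) (\<eta>, 0) z"
    if z: "z \<in> coord_dom c" for z \<eta>
  proof -
    obtain w where w: "w \<in> fst (lifted c)" "snd (lifted c) w = z"
      using dom_cases[OF c z] by metis
    have basis: "dd (dd (loc c E) (0, axis i 1)) (snd z, force c z) z = dd (loc c E) (axis i 1, 0) z" for i
    proof -
      have "dd (dd (loc c E) (0, axis i 1)) (snd z, force c z) z =
          chart_deriv (lifted c) (\<Gamma> w (lifted c)) (d_u A c i E) w"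
        unfolding chart_deriv_lifted spray_components[OF c w(1)] w(2)
        by (rule dd_cong[OF open_dom[OF c] z]) (rule loc_d_u[OF c, symmetric])
      also have "\<dots> = d_q A c i E w"
        using geodesic_spray c w(1) unfolding geodesic_spray_def by blast
      finally show ?thesis by (simp add: d_q_eq w(2))
    qed
    \<comment> \<open>The Euler-Lagrange equations are given for coordinate directions; both sides
      are linear in \<eta>.\<close>
    have lin: "linear (\<lambda>\<eta>. dd (dd (loc c E) (0, \<eta>)) (snd z, force c z) z)"
      by (rule linear_Pair_slots(1)[OF linear_dd_field_direction[OF energy_smooth[OF c] open_dom[OF c] z]])
    have lin': "linear (\<lambda>\<eta>. dd (loc c E) (\<eta>, 0) z)"
      by (rule linear_Pair_slots(2)[OF linear_dd[OF energy_differentiable(1)[OF c z]]])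
    show ?thesis
      unfolding linear_real_expand[OF lin, of \<eta>] linear_real_expand[OF lin', of \<eta>] basis ..
  qed
qed

end


section \<open>First integrals\<close>

locale finsler_special_tensor = finsler_spray M A E \<Gamma>
  for M :: "'p topology" and A :: "('p, real^'n) chart set" and E :: "('p, 'n) tvec \<Rightarrow> real"
    and \<Gamma> :: "('p, 'n) tvec \<Rightarrow> (('p, 'n) tvec, (real^'n) \<times> (real^'n)) tangent" +
  fixes K :: "('p, 'n) tvec \<Rightarrow> ('p, real^'n) tangent \<Rightarrow> ('p, real^'n) tangent"
    and \<alpha> :: "('p, 'n) tvec \<Rightarrow> ('p, real^'n) tangent \<Rightarrow> real"
    and X\<alpha> :: "('p, 'n) tvec \<Rightarrow> ('p, real^'n) tangent"
  assumes tensor: "tensor11_along A K"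
    and tensor_symmetric: "\<And>w X Y. w \<in> slit_bundle A \<Longrightarrow> X \<in> tangent_space A (fst w) \<Longrightarrow>
      Y \<in> tangent_space A (fst w) \<Longrightarrow> finsler_metric A E w (K w X) Y = finsler_metric A E w X (K w Y)"
    and field: "\<And>w. w \<in> slit_bundle A \<Longrightarrow> X\<alpha> w \<in> tangent_space A (fst w)"
    and field_dual: "\<And>w Y. w \<in> slit_bundle A \<Longrightarrow> Y \<in> tangent_space A (fst w) \<Longrightarrow>
      finsler_metric A E w (X\<alpha> w) Y = - \<alpha> w Y"
    and nabla_tensor: "\<And>c w i j. c \<in> A \<Longrightarrow> w \<in> fst (lift_chart A c) \<Longrightarrow>
      nabla11 A c \<Gamma> K i j w =
        1/2 * (tensor11_component A c (tensor_prod snd \<alpha>) i j w -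
               tensor11_component A c (tensor_prod X\<alpha> (theta A E)) i j w)"
begin

lemma tensor_endo: "w \<in> slit_bundle A \<Longrightarrow> tangent_endo A (fst w) (K w)"
  using tensor unfolding tensor11_along_def tangent_endo_def by blast

definition gmat :: "('p, real^'n) chart \<Rightarrow> (real^'n) \<times> (real^'n) \<Rightarrow> real^'n^'n" where
  "gmat c z = (\<chi> i j. dd (dd (loc c E) (0, axis i 1)) (0, axis j 1) z)"

definition kmat :: "('p, real^'n) chart \<Rightarrow> (real^'n) \<times> (real^'n) \<Rightarrow> real^'n^'n" where
  "kmat c z = (\<chi> i j. loc c (tensor11_component A c K i j) z)"

text \<open>The upper index of the connection coefficients is the row.\<close>

definition nmat :: "('p, real^'n) chart \<Rightarrow> (real^'n) \<times> (real^'n) \<Rightarrow> real^'n^'n" where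
  "nmat c z = matrix (\<lambda>\<xi>. (-1/2) *\<^sub>R dd (force c) (0, \<xi>) z)"

lemma gmat_metric:
  assumes c: "c \<in> A" and w: "w \<in> slit_bundle A" "fst w \<in> fst c"
    and XY: "X \<in> tangent_space A (fst w)" "Y \<in> tangent_space A (fst w)"
  shows "finsler_metric A E w X Y = X c \<bullet> (gmat c (snd (lifted c) w) *v Y c)"
proof -
  interpret LS: local_spray "coord_dom c" "loc c E" "force c" by (rule local_spray[OF c])
  have z: "snd (lifted c) w \<in> coord_dom c"
    by (rule lifted_in_dom[OF c in_lifted[OF w]])
  have "finsler_metric A E w X Y = LS.metric (snd (lifted c) w) (Y c) (X c)"
    unfolding LS.metric_def by (rule finsler_metric_eq[OF c w XY])
  also have "\<dots> = LS.metric (snd (lifted c) w) (X c) (Y c)"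
    by (rule LS.metric_sym[OF z])
  also have "\<dots> = X c \<bullet> (gmat c (snd (lifted c) w) *v Y c)"
    unfolding gmat_def LS.metric_def[symmetric] by (rule bilinear_matrix[OF LS.bilinear_metric[OF z]])
  finally show ?thesis .
qed

lemma kmat_eq:
  assumes "c \<in> A" "w \<in> fst (lifted c)"
  shows "kmat c (snd (lifted c) w) = endo_matrix A c (fst w) (K w)"
  by (simp add: kmat_def loc_apply[OF assms] tensor11_component_def vec_eq_iff)

lemma special_tensor_in_chart:
  assumes c: "c \<in> A" and w: "w \<in> fst (lifted c)"
  shows "special_tensor_at (gmat c) (kmat c) snd (snd (lifted c) w) (\<Gamma> w (lifted c))
    (nmat c (snd (lifted c) w)) (X\<alpha> w c)"
proof -
  interpret LS: local_spray "coord_dom c" "loc c E" "force c" by (rule local_spray[OF c])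
  define z where "z = snd (lifted c) w"
  have z: "z \<in> coord_dom c" unfolding z_def by (rule lifted_in_dom[OF c w])
  have ws: "w \<in> slit_bundle A" "fst w \<in> fst c" using lifted_in_slit[OF w] by auto
  have sz: "snd z = snd w c"
    using lifted_apply[of c "fst w" "snd w"] by (simp add: z_def)
  have spray: "\<Gamma> w (lifted c) = LS.spray z"
    unfolding LS.spray_def z_def by (rule spray_components[OF c w])
  have metric: "LS.metric y a b = a \<bullet> (gmat c y *v b)" if "y \<in> coord_dom c" for y a b
    unfolding gmat_def LS.metric_def[symmetric] by (rule bilinear_matrix[OF LS.bilinear_metric[OF that]])
  let ?G = "gmat c z" and ?K = "kmat c z" and ?N = "nmat c z" and ?X = "X\<alpha> w c"
  have lin_force: "linear (\<lambda>\<xi>. (-1/2) *\<^sub>R dd (force c) (0, \<xi>) z)"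
    using linear_vertical[OF LS.force_differentiable[OF z]] by (rule linear_compose_scale_right)
  have N: "?N *v \<xi> = (-1/2) *\<^sub>R dd (force c) (0, \<xi>) z" for \<xi>
    unfolding nmat_def by (rule fun_cong[OF matrix_vector_mul(2)[OF lin_force]])
  have diff_G: "gmat c differentiable (at z)"
    by (rule differentiable_matrix) (simp add: gmat_def LS.diff3[OF z])
  have diff_K: "kmat c differentiable (at z)"
  proof (rule differentiable_matrix)
    fix i j
    have "smooth_on (loc c (tensor11_component A c K i j)) (coord_dom c)"
      using tensor c unfolding tensor11_along_def smooth_in_lifted[OF c, symmetric] by blast
    then show "(\<lambda>y. kmat c y $ i $ j) differentiable (at z)"
      by (simp add: kmat_def smooth_on_differentiable[OF _ z])
  qed
  have diff_T: "(snd :: (real^'n) \<times> (real^'n) \<Rightarrow> _) differentiable (at z)"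
    by (rule bounded_linear_imp_differentiable[OF bounded_linear_snd])
  have G_sym: "transpose ?G = ?G"
    using LS.metric_sym[OF z] by (simp add: transpose_def vec_eq_iff gmat_def LS.metric_def)
  have G_swap: "(?G *v a) \<bullet> b = a \<bullet> (?G *v b)" for a b
    using LS.metric_sym[OF z, of a b] unfolding metric[OF z] by (simp add: inner_commute)
  have transp: "a \<bullet> (transpose B *v b) = (B *v a) \<bullet> b" for a b and B :: "real^'n^'n"
    by (metis dot_lmul_matrix inner_commute transpose_matrix_vector)
  have coord_vec: "tangent_of A c (fst w) x \<in> tangent_space A (fst w)"
    "tangent_of A c (fst w) x c = x" for x
    by (simp_all add: tangent_of_in_tangent_space tangent_of_same c ws)
  have K_vec: "K w Y \<in> tangent_space A (fst w)" "K w Y c = ?K *v Y c"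
    if "Y \<in> tangent_space A (fst w)" for Y
    using that tensor_endo[OF ws(1)] endo_matrix_works[OF c ws(2) tensor_endo[OF ws(1)] that]
    by (simp_all add: tangent_endo_def z_def kmat_eq[OF c w])
  have self_adjoint: "transpose ?K ** ?G = ?G ** ?K"
  proof (rule matrix_eqI)
    fix i j
    let ?i = "tangent_of A c (fst w) (axis i 1)" and ?j = "tangent_of A c (fst w) (axis j 1)"
    have "finsler_metric A E w (K w ?i) ?j = finsler_metric A E w ?i (K w ?j)"
      by (intro tensor_symmetric ws coord_vec)
    then have "(?K *v axis i 1) \<bullet> (?G *v axis j 1) = axis i 1 \<bullet> (?G *v (?K *v axis j 1))"
      by (simp only: gmat_metric[OF c ws] K_vec coord_vec z_def[symmetric])
    then show "axis i 1 \<bullet> ((transpose ?K ** ?G) *v axis j 1) = axis i 1 \<bullet> ((?G ** ?K) *v axis j 1)"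
      by (simp only: matrix_vector_mul_assoc[symmetric] transp)
  qed
  \<comment> \<open>Entrywise this is \<open>metric_parallel\<close>, with the vertical derivative
    of the force rewritten through \<open>nmat\<close>.\<close>
  have dd_G: "dd (gmat c) (\<Gamma> w (lifted c)) z = transpose ?N ** ?G + ?G ** ?N"
  proof (rule matrix_eqI)
    fix i j
    have "axis i 1 \<bullet> (dd (gmat c) (\<Gamma> w (lifted c)) z *v axis j 1) =
        dd (\<lambda>y. LS.metric y (axis i 1) (axis j 1)) (LS.spray z) z"
      unfolding matrix_entry[symmetric] dd_matrix_entry[OF diff_G] spray
      by (simp add: gmat_def LS.metric_def)
    also have "\<dots> = - (LS.metric z (axis i 1) (dd (force c) (0, axis j 1) z) +
        LS.metric z (axis j 1) (dd (force c) (0, axis i 1) z)) / 2"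
      by (rule LS.metric_parallel[OF z])
    also have "\<dots> = axis i 1 \<bullet> (?G *v (?N *v axis j 1)) + axis j 1 \<bullet> (?G *v (?N *v axis i 1))"
      unfolding N metric[OF z] by (simp add: matrix_simps)
    also have "axis j 1 \<bullet> (?G *v (?N *v axis i 1)) = (?N *v axis i 1) \<bullet> (?G *v axis j 1)"
      by (metis G_swap inner_commute)
    finally show "axis i 1 \<bullet> (dd (gmat c) (\<Gamma> w (lifted c)) z *v axis j 1) =
        axis i 1 \<bullet> ((transpose ?N ** ?G + ?G ** ?N) *v axis j 1)"
      by (simp only: matrix_vector_mult.add_left inner_add_right matrix_vector_mul_assoc[symmetric]
          transp add.commute)
  qed
  \<comment> \<open>Along the spray the velocity changes by \<open>F\<close>, and homogeneity gives
    N u = -1/2 (2 F) = - F.\<close>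
  have dd_T: "dd snd (\<Gamma> w (lifted c)) z = - (?N *v snd z)"
    unfolding N LS.force_homogeneous[OF z] spray LS.spray_def
    by (simp add: dd_eqI[OF has_derivative_snd[OF has_derivative_ident]])
  have dd_K: "dd (kmat c) (\<Gamma> w (lifted c)) z = ?K ** ?N - ?N ** ?K +
      (-1/2) *\<^sub>R ((\<chi> i j. snd z $ i * (?G *v ?X) $ j) + (\<chi> i j. ?X $ i * (?G *v snd z) $ j))"
  proof -
    have entry: "dd (kmat c) (\<Gamma> w (lifted c)) z $ i $ j = (?K ** ?N) $ i $ j - (?N ** ?K) $ i $ j
        - 1/2 * (snd z $ i * (?G *v ?X) $ j + ?X $ i * (?G *v snd z) $ j)" for i j
    proof -
      let ?j = "tangent_of A c (fst w) (axis j 1)"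
      have comp: "tensor11_component A c K i j w = ?K $ i $ j" for i j
        by (simp add: kmat_def z_def loc_apply[OF c w])
      have conn: "conn_coeff A c \<Gamma> k l w = ?N $ k $ l" for k l
      proof -
        have "dd (\<lambda>y. force c y $ k) (0, axis l 1) z = dd (force c) (0, axis l 1) z $ k"
          by (rule dd_bounded_linear[OF bounded_linear_vec_nth LS.force_differentiable[OF z]])
        moreover have "loc c (\<lambda>w'. snd (\<Gamma> w' (lifted c)) $ k) = (\<lambda>y. force c y $ k)"
          by (simp add: loc_def force_def o_def)
        ultimately show ?thesis
          by (simp add: conn_coeff_def d_u_eq z_def[symmetric] matrix_entry[of ?N] N inner_axis')
      qed
      have "nabla11 A c \<Gamma> K i j w = dd (\<lambda>y. kmat c y $ i $ j) (\<Gamma> w (lifted c)) z +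
          (?N ** ?K) $ i $ j - (?K ** ?N) $ i $ j"
        unfolding nabla11_def chart_deriv_lifted comp conn z_def[symmetric]
        by (simp add: kmat_def matrix_matrix_mult_def mult.commute)
      \<comment> \<open>Lowering the index of the dual field gives \<alpha>_j = - (G X)_j, the
        source of the minus sign.\<close>
      moreover have "tensor11_component A c (tensor_prod snd \<alpha>) i j w = - (snd z $ i * (?G *v ?X) $ j)"
      proof -
        have "- \<alpha> w ?j = finsler_metric A E w (X\<alpha> w) ?j"
          by (rule field_dual[symmetric]) (simp_all add: ws coord_vec)
        also have "\<dots> = ?X \<bullet> (?G *v axis j 1)"
          by (simp only: gmat_metric[OF c ws field[OF ws(1)] coord_vec(1)] coord_vec(2) z_def)
        also have "\<dots> = (?G *v ?X) $ j"
          unfolding G_swap[symmetric] by (simp add: inner_axis)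
        finally have "\<alpha> w ?j = - (?G *v ?X) $ j" by simp
        then show ?thesis
          by (simp add: tensor11_component_def endo_matrix_def tensor_prod_def sz)
      qed
      moreover have "tensor11_component A c (tensor_prod X\<alpha> (theta A E)) i j w = ?X $ i * (?G *v snd z) $ j"
      proof -
        have "theta A E w ?j = dd (loc c E) (0, axis j 1) z"
          by (simp only: theta_eq[OF c ws coord_vec(1)] coord_vec(2) z_def)
        also have "\<dots> = axis j 1 \<bullet> (?G *v snd z)"
          unfolding metric[OF z, symmetric] by (rule LS.metric_velocity(2)[OF z, symmetric])
        finally show ?thesis
          by (simp add: tensor11_component_def endo_matrix_def tensor_prod_def inner_axis')
      qed
      ultimately have "dd (\<lambda>y. kmat c y $ i $ j) (\<Gamma> w (lifted c)) z + (?N ** ?K) $ i $ j - (?K ** ?N) $ i $ j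
          = 1/2 * (- (snd z $ i * (?G *v ?X) $ j) - ?X $ i * (?G *v snd z) $ j)"
        using nabla_tensor[OF c w, of i j] by simp
      then show ?thesis
        unfolding dd_matrix_entry[OF diff_K] by (simp add: algebra_simps)
    qed
    show ?thesis
      unfolding vec_eq_iff by (simp add: entry)
  qed
  show ?thesis
    unfolding z_def[symmetric]
    by (rule special_tensor_at.intro[OF diff_G diff_K diff_T G_sym self_adjoint dd_G dd_T dd_K])
qed

lemma h_first_integral:
  assumes w: "w \<in> slit_bundle A"
  shows "lie_derivative (slit_atlas A) \<Gamma> (h_fun A E K l) w = 0"
proof -
  obtain c0 where "c0 \<in> A" "fst w \<in> fst c0"
    using w by (auto simp: slit_bundle_def tangent_bundle_def)
  then have "\<exists>C. C \<in> slit_atlas A \<and> w \<in> fst C"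
    using in_lifted[OF w, of c0] unfolding slit_atlas_def by blast
  \<comment> \<open>The chart in which \<open>lie_derivative\<close> differentiates is an arbitrary
    choice, but it is the lift of some chart \<open>c\<close>, and all further computation takes
    place in that \<open>c\<close>.\<close>
  from someI_ex[OF this] have "chart_at (slit_atlas A) w \<in> slit_atlas A" "w \<in> fst (chart_at (slit_atlas A) w)"
    unfolding chart_at_def by auto
  then obtain c where c: "c \<in> A" "w \<in> fst (lifted c)" "chart_at (slit_atlas A) w = lifted c"
    by (auto simp: slit_atlas_def)
  interpret ST: special_tensor_at "gmat c" "kmat c" snd "snd (lifted c) w" "\<Gamma> w (lifted c)"
    "nmat c (snd (lifted c) w)" "X\<alpha> w c"
    by (rule special_tensor_in_chart[OF c(1,2)])
  interpret LS: local_spray "coord_dom c" "loc c E" "force c" by (rule local_spray[OF c(1)])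
  \<comment> \<open>Equality at \<open>w\<close> alone would not allow differentiation. At every
    nearby point the trace and the metric are carried to the same chart \<open>c\<close>, whatever
    \<open>chart_at\<close> selects there.\<close>
  have h: "loc c (h_fun A E K l) y = (\<Sum>i\<le>l. exp_coeff (\<lambda>j. ST.aa j y) i * ST.kk (l - i) y)"
    if y: "y \<in> coord_dom c" for y
  proof -
    obtain w' where w': "w' \<in> fst (lifted c)" "snd (lifted c) w' = y"
      using dom_cases[OF c(1) y] by metis
    have ws: "w' \<in> slit_bundle A" "fst w' \<in> fst c" using lifted_in_slit[OF w'(1)] by auto
    have kmat_y: "kmat c y = endo_matrix A c (fst w') (K w')"
      using kmat_eq[OF c(1) w'(1)] w'(2) by simp
    have v: "snd w' \<in> tangent_space A (fst w')" by (rule velocity_in_tangent_space[OF ws(1)])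
    have sy: "snd w' c = snd y"
      using lifted_apply[of c "fst w'" "snd w'"] w'(2) by simp
    note endo = tensor_endo[OF ws(1)]
    have a: "a_fun A K j w' = ST.aa j y" for j
      unfolding a_fun_def ST.aa_def kmat_y fibre_trace_eq[OF c(1) ws(2) tangent_endo_funpow[OF endo]]
        endo_matrix_funpow[OF c(1) ws(2) endo] ..
    have k: "k_fun A E K j w' = ST.kk j y" for j
    proof (cases "j = 0")
      case True
      have "E w' = loc c E y"
        using loc_apply[OF c(1) w'(1), of E] w'(2) by simp
      also have "\<dots> = 1/2 * LS.metric y (snd y) (snd y)"
        by (rule LS.energy_metric[OF y])
      also have "LS.metric y (snd y) (snd y) = snd y \<bullet> (gmat c y *v snd y)"
        unfolding gmat_def LS.metric_def[symmetric] by (rule bilinear_matrix[OF LS.bilinear_metric[OF y]])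
      finally show ?thesis using True by (simp add: k_fun_def ST.kk_def)
    next
      case False
      have "(K w' ^^ j) (snd w') \<in> tangent_space A (fst w')"
        using tangent_endo_funpow[OF endo] v by (simp add: tangent_endo_def)
      from gmat_metric[OF c(1) ws v this]
      show ?thesis
        using False endo_matrix_works[OF c(1) ws(2) tangent_endo_funpow[OF endo] v, of j]
        by (simp add: k_fun_def ST.kk_def w'(2) sy kmat_y endo_matrix_funpow[OF c(1) ws(2) endo])
    qed
    have b: "b_fun A K i w' = exp_coeff (\<lambda>j. ST.aa j y) i" if "i \<noteq> 0" for i
      using that by (simp add: b_fun_def exp_coeff_def a)
    have "loc c (h_fun A E K l) y = h_fun A E K l w'"
      using loc_apply[OF c(1) w'(1), of "h_fun A E K l"] w'(2) by simp
    \<comment> \<open>For l = 0 the sum is empty and k_0 = E, so the two cases of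
      \<open>h_fun\<close> merge.\<close>
    also have "\<dots> = k_fun A E K l w' + (\<Sum>i = 1..l. b_fun A K i w' * k_fun A E K (l - i) w')"
      by (simp add: h_fun_def k_fun_def)
    also have "(\<Sum>i = 1..l. b_fun A K i w' * k_fun A E K (l - i) w') =
        (\<Sum>i = 1..l. exp_coeff (\<lambda>j. ST.aa j y) i * ST.kk (l - i) y)"
      by (rule sum.cong) (auto simp: b k)
    also have "k_fun A E K l w' + \<dots> = (\<Sum>i\<in>insert 0 {1..l}. exp_coeff (\<lambda>j. ST.aa j y) i * ST.kk (l - i) y)"
      by (simp add: exp_coeff_def k)
    also have "insert 0 {1..l} = {..l}" by auto
    finally show ?thesis .
  qed
  have "lie_derivative (slit_atlas A) \<Gamma> (h_fun A E K l) w =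
      dd (loc c (h_fun A E K l)) (\<Gamma> w (lifted c)) (snd (lifted c) w)"
    by (simp add: lie_derivative_def Let_def c(3) chart_deriv_lifted)
  also have "\<dots> = dd (\<lambda>y. \<Sum>i\<le>l. exp_coeff (\<lambda>j. ST.aa j y) i * ST.kk (l - i) y)
      (\<Gamma> w (lifted c)) (snd (lifted c) w)"
    by (rule dd_cong[OF open_dom[OF c(1)] lifted_in_dom[OF c(1,2)] h])
  also have "\<dots> = 0" by (rule ST.first_integral)
  finally show ?thesis .
qed

end

theorem theorem2:
  fixes M :: "'p topology"
    and A :: "('p, real^'n) chart set"
    and E :: "('p, 'n) tvec \<Rightarrow> real"
    and \<Gamma> :: "('p, 'n) tvec \<Rightarrow> (('p, 'n) tvec, (real^'n) \<times> (real^'n)) tangent"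
    and K :: "('p, 'n) tvec \<Rightarrow> ('p, real^'n) tangent \<Rightarrow> ('p, real^'n) tangent"
    and \<alpha> :: "('p, 'n) tvec \<Rightarrow> ('p, real^'n) tangent \<Rightarrow> real"
    and X\<alpha> :: "('p, 'n) tvec \<Rightarrow> ('p, real^'n) tangent"
  assumes "smooth_manifold M A"
    and "finsler_space A E"
    and "geodesic_spray A E \<Gamma>"
    and "tensor11_along A K"
    and "\<forall>w\<in>slit_bundle A. \<forall>X\<in>tangent_space A (fst w). \<forall>Y\<in>tangent_space A (fst w).
           finsler_metric A E w (K w X) Y = finsler_metric A E w X (K w Y)"
    and "one_form_along A \<alpha>"
    and "vector_field_along A X\<alpha>"
    and "\<forall>w\<in>slit_bundle A. \<forall>Y\<in>tangent_space A (fst w).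
           finsler_metric A E w (X\<alpha> w) Y = - \<alpha> w Y"
    and "\<forall>c\<in>A. \<forall>w\<in>fst (lift_chart A c). \<forall>i j.
           nabla11 A c \<Gamma> K i j w =
           1/2 * (tensor11_component A c (tensor_prod snd \<alpha>) i j w -
                  tensor11_component A c (tensor_prod X\<alpha> (theta A E)) i j w)"
  shows "\<forall>l. \<forall>w\<in>slit_bundle A. lie_derivative (slit_atlas A) \<Gamma> (h_fun A E K l) w = 0"
proof -
  interpret finsler_special_tensor M A E \<Gamma> K \<alpha> X\<alpha>
  proof
    show "X\<alpha> w \<in> tangent_space A (fst w)" if "w \<in> slit_bundle A" for w
      using assms(7) that unfolding vector_field_along_def by blast
  qed (use assms in blast)+
  show ?thesis using h_first_integral by blast
qed

end
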